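(* Let $G$ be a finite group. Then $|c(G)|=7$ if and only if $G$ is isomorphic to one of the groups $D_8$, $D_{10}$, $Z_3\rtimes Z_4$, $C_5\times C_5$, or $C_{p^6}$ for some prime $p$.
   Context: For a finite group $G$, $c(G)$ denotes the set of all cyclic subgroups of $G$ (including the trivial subgroup), so $|c(G)|$ is the number of cyclic subgroups of $G$. $C_n$ denotes the cyclic group of order $n$. $D_{8}$ and $D_{10}$ denote the dihedral groups of order $8$ and $10$ respectively. $Z_3\rtimes Z_4$ denotes the non-abelian semidirect product of order $12$, $\langle a,b\mid a^3=b^4=1,\ bab^{-1}=a^{-1}\rangle$. *)

theory Defs
  imports "HOL-Algebra.Algebra" "HOL-Algebra.Elementary_Groups"
begin

definition cyclic_subgroups :: "('a, 'b) monoid_scheme \<Rightarrow> 'a set set" where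
  "cyclic_subgroups G = {H. subgroup H G \<and> cyclic_group (G\<lparr>carrier := H\<rparr>)}"

text \<open>
  The semidirect product of \<open>N\<close> by \<open>H\<close> along \<open>\<phi>\<close>, where \<open>\<phi> h\<close> is the automorphism of \<open>N\<close>
  by which \<open>h\<close> acts; the normal factor comes first.
\<close>

definition semidirect_product ::
  "('a, 'c) monoid_scheme \<Rightarrow> ('b, 'd) monoid_scheme \<Rightarrow> ('b \<Rightarrow> 'a \<Rightarrow> 'a) \<Rightarrow> ('a \<times> 'b) monoid" where
  "semidirect_product N H \<phi> =
    \<lparr>carrier = carrier N \<times> carrier H,
     monoid.mult = (\<lambda>(n, h) (n', h'). (n \<otimes>\<^bsub>N\<^esub> \<phi> h n', h \<otimes>\<^bsub>H\<^esub> h')),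
     one = (\<one>\<^bsub>N\<^esub>, \<one>\<^bsub>H\<^esub>)\<rparr>"

text \<open>
  The action on an abelian group \<open>N\<close> of the integers, and hence of \<open>integer_mod_group k\<close> for even
  \<open>k\<close>, in which \<open>1\<close> acts by inversion.
\<close>

definition inversion_action :: "('a, 'c) monoid_scheme \<Rightarrow> int \<Rightarrow> 'a \<Rightarrow> 'a" where
  "inversion_action N h x = (if even h then x else inv\<^bsub>N\<^esub> x)"

text \<open>The index is half the order: \<open>dihedral_group n\<close> has order \<open>2 * n\<close>.\<close>

definition dihedral_group :: "nat \<Rightarrow> (int \<times> int) monoid" where
  "dihedral_group n =
    semidirect_product (integer_mod_group n) (integer_mod_group 2)
      (inversion_action (integer_mod_group n))"

definition Z3_semidirect_Z4 :: "(int \<times> int) monoid" where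
  "Z3_semidirect_Z4 =
    semidirect_product (integer_mod_group 3) (integer_mod_group 4)
      (inversion_action (integer_mod_group 3))"

lemma group_semidirect_product:
  assumes "group N" "group H"
    and hom: "\<And>h. h \<in> carrier H \<Longrightarrow> \<phi> h \<in> hom N N"
    and one: "\<And>n. n \<in> carrier N \<Longrightarrow> \<phi> \<one>\<^bsub>H\<^esub> n = n"
    and mult: "\<And>h h' n. \<lbrakk>h \<in> carrier H; h' \<in> carrier H; n \<in> carrier N\<rbrakk> \<Longrightarrow>
                 \<phi> (h \<otimes>\<^bsub>H\<^esub> h') n = \<phi> h (\<phi> h' n)"
  shows "group (semidirect_product N H \<phi>)"
proof -
  interpret N: group N by fact
  interpret H: group H by fact
  have cl [simp]: "\<phi> h n \<in> carrier N" if "h \<in> carrier H" "n \<in> carrier N" for h n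
    using hom[OF that(1)] that(2) by (auto simp: hom_def)
  have dist: "\<phi> h (n \<otimes>\<^bsub>N\<^esub> n') = \<phi> h n \<otimes>\<^bsub>N\<^esub> \<phi> h n'"
    if "h \<in> carrier H" "n \<in> carrier N" "n' \<in> carrier N" for h n n'
    using hom[OF that(1)] that(2,3) by (auto simp: hom_def)
  show ?thesis
  proof (rule groupI)
    fix x assume "x \<in> carrier (semidirect_product N H \<phi>)"
    then obtain n h where x: "x = (n, h)" "n \<in> carrier N" "h \<in> carrier H"
      by (auto simp: semidirect_product_def)
    let ?y = "(\<phi> (inv\<^bsub>H\<^esub> h) (inv\<^bsub>N\<^esub> n), inv\<^bsub>H\<^esub> h)"
    have "?y \<otimes>\<^bsub>semidirect_product N H \<phi>\<^esub> x = \<one>\<^bsub>semidirect_product N H \<phi>\<^esub>"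
    proof -
      have "\<phi> (inv\<^bsub>H\<^esub> h) \<one>\<^bsub>N\<^esub> = \<one>\<^bsub>N\<^esub>"
        using hom[of "inv\<^bsub>H\<^esub> h"] x by (simp add: hom_one)
      then show ?thesis
        using x dist[of "inv\<^bsub>H\<^esub> h" "inv\<^bsub>N\<^esub> n" n] by (simp add: semidirect_product_def)
    qed
    then show "\<exists>y\<in>carrier (semidirect_product N H \<phi>).
        y \<otimes>\<^bsub>semidirect_product N H \<phi>\<^esub> x = \<one>\<^bsub>semidirect_product N H \<phi>\<^esub>"
      using x by (intro bexI[of _ ?y]) (auto simp: semidirect_product_def)
  qed (auto simp: semidirect_product_def one mult dist N.m_assoc H.m_assoc)
qed

lemma group_inversion_semidirect_product:
  assumes "comm_group N" "even k"
  shows "group (semidirect_product N (integer_mod_group k) (inversion_action N))"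
proof -
  interpret comm_group N by fact
  have par: "even ((x + y) mod int k) \<longleftrightarrow> even (x + y)" for x y :: int
    using \<open>even k\<close> by (simp add: dvd_mod_iff)
  show ?thesis
    by (rule group_semidirect_product)
       (auto simp: inversion_action_def hom_def inv_mult par is_group)
qed

lemma group_dihedral_group: "group (dihedral_group n)"
  unfolding dihedral_group_def by (rule group_inversion_semidirect_product) simp_all

lemma order_dihedral_group: "n > 0 \<Longrightarrow> order (dihedral_group n) = 2 * n"
  by (simp add: order_def dihedral_group_def semidirect_product_def carrier_integer_mod_group)

lemma group_Z3_semidirect_Z4: "group Z3_semidirect_Z4"
  unfolding Z3_semidirect_Z4_def by (rule group_inversion_semidirect_product) simp_all

lemma order_Z3_semidirect_Z4: "order Z3_semidirect_Z4 = 12"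
  by (simp add: order_def Z3_semidirect_Z4_def semidirect_product_def carrier_integer_mod_group)

text \<open>The defining relations hold for \<open>a = (1, 0)\<close> and \<open>b = (0, 1)\<close>.\<close>

lemma Z3_semidirect_Z4_relations:
  fixes a b :: "int \<times> int"
  defines "a \<equiv> (1, 0)" and "b \<equiv> (0, 1)"
  shows "a \<in> carrier Z3_semidirect_Z4" "b \<in> carrier Z3_semidirect_Z4"
    and "a [^]\<^bsub>Z3_semidirect_Z4\<^esub> (3::nat) = \<one>\<^bsub>Z3_semidirect_Z4\<^esub>"
    and "b [^]\<^bsub>Z3_semidirect_Z4\<^esub> (4::nat) = \<one>\<^bsub>Z3_semidirect_Z4\<^esub>"
    and "b \<otimes>\<^bsub>Z3_semidirect_Z4\<^esub> a \<otimes>\<^bsub>Z3_semidirect_Z4\<^esub> inv\<^bsub>Z3_semidirect_Z4\<^esub> b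
           = inv\<^bsub>Z3_semidirect_Z4\<^esub> a"
    and "a \<otimes>\<^bsub>Z3_semidirect_Z4\<^esub> b \<noteq> b \<otimes>\<^bsub>Z3_semidirect_Z4\<^esub> a"
proof -
  interpret group Z3_semidirect_Z4 by (rule group_Z3_semidirect_Z4)
  have one1: "(1::int) \<in> carrier (integer_mod_group 3)" by simp
  note defs = Z3_semidirect_Z4_def semidirect_product_def inversion_action_def a_def b_def
    carrier_integer_mod_group
  show ab: "a \<in> carrier Z3_semidirect_Z4" "b \<in> carrier Z3_semidirect_Z4"
    by (auto simp: defs)
  show "a [^]\<^bsub>Z3_semidirect_Z4\<^esub> (3::nat) = \<one>\<^bsub>Z3_semidirect_Z4\<^esub>"
       "b [^]\<^bsub>Z3_semidirect_Z4\<^esub> (4::nat) = \<one>\<^bsub>Z3_semidirect_Z4\<^esub>"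
    by (simp_all add: numeral_eq_Suc nat_pow_def) (simp_all add: defs)
  have ia: "inv\<^bsub>Z3_semidirect_Z4\<^esub> a = (2, 0)"
    by (rule inv_equality) (auto simp: defs)
  have ib: "inv\<^bsub>Z3_semidirect_Z4\<^esub> b = (0, 3)"
    by (rule inv_equality) (auto simp: defs)
  show "b \<otimes>\<^bsub>Z3_semidirect_Z4\<^esub> a \<otimes>\<^bsub>Z3_semidirect_Z4\<^esub> inv\<^bsub>Z3_semidirect_Z4\<^esub> b
      = inv\<^bsub>Z3_semidirect_Z4\<^esub> a"
    unfolding ia ib by (simp add: defs)
  show "a \<otimes>\<^bsub>Z3_semidirect_Z4\<^esub> b \<noteq> b \<otimes>\<^bsub>Z3_semidirect_Z4\<^esub> a"
    by (simp add: defs)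
qed

end

theory Submission
  imports Defs "HOL-Number_Theory.Totient"
begin

text \<open>
  Let \<open>x\<close> have maximal order \<open>m\<close> and let \<open>|G| = k * m\<close>. There are \<open>c = 7 - \<tau>(m)\<close> cyclic subgroups \<open>H\<close>
  not contained in \<open>\<langle>x\<rangle>\<close>, and counting generators gives \<open>\<Sum> \<phi>(|H|) = (k - 1) * m\<close> over these. If
  \<open>k = 1\<close>, then \<open>\<tau>(|G|) = 7\<close> and \<open>|G| = p^6\<close>. Otherwise, by the pigeonhole principle, every \<open>g\<close> has a
  power \<open>g^t\<close> with \<open>1 \<le> t \<le> k\<close> in \<open>\<langle>x\<rangle>\<close>, so that an element outside \<open>\<langle>x\<rangle>\<close> has order \<open>j * d\<close> with
  \<open>2 \<le> j \<le> k\<close> and \<open>d\<close> a proper divisor of \<open>m\<close>. As \<open>\<phi>(j * d) \<le> (j - 1) * d\<close>, this forces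
  \<open>m \<le> c * d\<close> for the largest such \<open>d\<close>, which leaves very few pairs \<open>(m, k)\<close>. Besides those of the
  four listed groups, these are orders 12 and 15, where an element of order 6 or 15 contradicts
  maximality, and orders 16, 32 and 81, with two cyclic subgroups of prime index \<open>p\<close> but no
  element of order \<open>p\<close> outside \<open>\<langle>x\<rangle>\<close>, which is impossible.
\<close>

text \<open>The subgroup \<open>\<langle>x\<rangle>\<close> need not be normal, so an element
  outside it has no order modulo \<open>\<langle>x\<rangle>\<close>; the pigeonhole exponent takes
  the place of that order. Maximality of \<open>m\<close> makes the estimate effective:
  \<open>2 * d \<le> j * d \<le> m\<close> gives \<open>d \<le> m / 2\<close>, hence
  \<open>c \<ge> 2\<close> and \<open>\<tau>(m) \<le> 5\<close>. So \<open>m\<close> is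
  \<open>p\<close>, \<open>p^2\<close>, \<open>p^3\<close>, \<open>p^4\<close> or
  \<open>p * q\<close>, and with the largest proper divisor in each case
  \<open>m \<le> c * d\<close> bounds the smallest prime factor of \<open>m\<close>. The index is
  bounded separately by \<open>k - 1 < c\<close>, since every \<open>\<phi>(|H|)\<close> is less
  than \<open>m\<close>. What remains is a sum of \<open>c\<close> totients with a prescribed value.
  Often this value is extreme, so that all \<open>H\<close> have the same order, and the group is
  recognised from its element orders. Orders 16, 32 and 81 pass every such count, so there an
  explicit element has to be constructed.\<close>

hide_const (open) Divisibility.prime

section \<open>Totients and numbers with few divisors\<close>

text \<open>Among \<open>1, ..., j * d\<close> the \<open>d\<close> multiples of \<open>j\<close>
  share the factor \<open>j \<ge> 2\<close> with \<open>j * d\<close>, so they are not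
  totatives.\<close>

lemma totient_mult_le:
  assumes "j \<ge> 2"
  shows "totient (j * d) \<le> (j - 1) * d"
proof -
  have "totatives (j * d) \<subseteq> {0<..j * d} - (*) j ` {0<..d}"
    using assms by (auto simp: totatives_def)
  then have "totient (j * d) \<le> card ({0<..j * d} - (*) j ` {0<..d})"
    unfolding totient_def by (intro card_mono) auto
  also have "\<dots> = card {0<..j * d} - card ((*) j ` {0<..d})"
    using assms by (intro card_Diff_subset) auto
  also have "card ((*) j ` {0<..d}) = d"
    using assms by (subst card_image) (auto simp: inj_on_def)
  finally show ?thesis by (simp add: diff_mult_distrib)
qed

text \<open>Sending \<open>(i, d)\<close> to \<open>p ^ i * d\<close> is a bijection onto the
  divisors: \<open>i\<close> is recovered as the multiplicity of \<open>p\<close>, and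
  \<open>d\<close> by cancellation.\<close>

lemma card_divisors_prime_power_mult:
  fixes p r :: nat
  assumes p: "prime p" and r: "\<not> p dvd r"
  shows "card {d. d dvd p ^ a * r} = (a + 1) * card {d. d dvd r}"
proof -
  have "bij_betw (\<lambda>(i, d). p ^ i * d) ({..a} \<times> {d. d dvd r}) {d. d dvd p ^ a * r}"
  proof (rule bij_betwI', goal_cases)
    case (1 x y)
    obtain i d j e where [simp]: "x = (i, d)" "y = (j, e)" by fastforce
    have "i = j \<and> d = e" if eq: "p ^ i * d = p ^ j * e"
    proof -
      have "d dvd r" "e dvd r" using 1 by auto
      have nd: "\<not> p dvd d" "\<not> p dvd e" using r dvd_trans \<open>d dvd r\<close> \<open>e dvd r\<close> by blast+
      have "multiplicity p (p ^ i * d) = i" "multiplicity p (p ^ j * e) = j"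
        using nd p by (auto intro!: multiplicity_eqI)
      then have "i = j" using eq by simp
      then show ?thesis using eq p by auto
    qed
    then show ?case by auto
  next
    case (2 x)
    then show ?case by (auto intro!: mult_dvd_mono le_imp_power_dvd)
  next
    case (3 y)
    then obtain b c where bc: "y = b * c" "b dvd p ^ a" "c dvd r"
      using division_decomp by blast
    then obtain i where "i \<le> a" "b = p ^ i"
      using p by (auto simp: divides_primepow_nat)
    then show ?case using bc by auto
  qed
  from bij_betw_same_card[OF this] show ?thesis by (simp add: card_cartesian_product)
qed

lemma card_divisors_prime_power:
  fixes p :: nat
  assumes "prime p"
  shows "card {d. d dvd p ^ a} = a + 1"
  using card_divisors_prime_power_mult[OF assms, of 1 a] prime_gt_1_nat[OF assms] by simp

lemma card_divisors_eq_1_iff: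
  fixes n :: nat
  assumes "n > 0"
  shows "card {d. d dvd n} = 1 \<longleftrightarrow> n = 1"
proof
  assume "card {d. d dvd n} = 1"
  then obtain c where c: "{d. d dvd n} = {c}" using card_1_singletonE by metis
  have "1 \<in> {d. d dvd n}" "n \<in> {d. d dvd n}" by simp_all
  then show "n = 1" unfolding c by simp
qed simp

text \<open>Splitting off one prime with its full multiplicity exhibits a factor
  \<open>a + 1 \<ge> 2\<close> of the divisor count; for small counts this replaces a full
  factorisation.\<close>

lemma prime_power_mult_decomp:
  fixes n :: nat
  assumes "n > 1"
  obtains p a r where "prime p" "a > 0" "\<not> p dvd r" "r > 0" "n = p ^ a * r"
    "card {d. d dvd n} = (a + 1) * card {d. d dvd r}" "card {d. d dvd r} > 0"
proof -
  obtain p where p: "prime p" "p dvd n" using assms by (metis less_irrefl prime_factor_nat)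
  have "n \<noteq> 0" "\<not> is_unit p" using assms p by auto
  then obtain r where r: "n = p ^ multiplicity p n * r" "\<not> p dvd r"
    using multiplicity_decompose' by metis
  have "multiplicity p n > 0" using p assms by (simp add: prime_multiplicity_gt_zero_iff)
  moreover have "r > 0" using r assms by (metis gr0I mult_0_right not_one_less_zero)
  ultimately show ?thesis
    using that[OF p(1) _ r(2) _ r(1)] card_divisors_prime_power_mult[OF p(1) r(2), of "multiplicity p n"] r(1)
      finite_divisors_nat[of r] by (metis card_gt_0_iff dvd_refl empty_iff mem_Collect_eq)
qed

lemma card_divisors_eq_2:
  fixes n :: nat
  assumes "card {d. d dvd n} = 2" "n > 0"
  shows "prime n"
proof -
  have "n > 1" using assms card_divisors_eq_1_iff[of n] by (cases "n = 1") auto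
  then obtain p a r where d: "prime p" "a > 0" "\<not> p dvd r" "r > 0" "n = p ^ a * r"
    "card {d. d dvd n} = (a + 1) * card {d. d dvd r}" "card {d. d dvd r} > 0"
    using prime_power_mult_decomp by metis
  have "a + 1 dvd 2" using d assms(1) by (metis dvd_triv_left)
  then have "a + 1 \<le> 2" by (rule dvd_imp_le) simp
  then have "a = 1" using d(2) by simp
  then have "card {d. d dvd r} = 1" using d(6) assms(1) by simp
  then show ?thesis using d card_divisors_eq_1_iff \<open>a = 1\<close> by simp
qed

text \<open>The count is \<open>(a + 1) * t\<close> with \<open>a + 1 \<ge> 2\<close> and
  \<open>t\<close> the divisor count of the cofactor, so \<open>t \<le> 2\<close> and the cofactor
  is \<open>1\<close> or a prime.\<close>

lemma card_divisors_le_5: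
  fixes m :: nat
  assumes "card {d. d dvd m} \<le> 5" "m > 1"
  obtains (prime) "prime m" "card {d. d dvd m} = 2"
    | (square) p where "prime p" "m = p ^ 2" "card {d. d dvd m} = 3"
    | (cube) p where "prime p" "m = p ^ 3" "card {d. d dvd m} = 4"
    | (fourth) p where "prime p" "m = p ^ 4" "card {d. d dvd m} = 5"
    | (semiprime) p q where "prime p" "prime q" "p < q" "m = p * q" "card {d. d dvd m} = 4"
proof -
  obtain p a r where d: "prime p" "a > 0" "\<not> p dvd r" "r > 0" "m = p ^ a * r"
    "card {d. d dvd m} = (a + 1) * card {d. d dvd r}" "card {d. d dvd r} > 0"
    using prime_power_mult_decomp[OF assms(2)] by metis
  define t where "t = card {d. d dvd r}"
  have t: "(a + 1) * t \<le> 5" "t > 0" using assms d by (auto simp: t_def)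
  have "t < 3"
  proof (rule ccontr)
    assume "\<not> t < 3"
    then have "2 * 3 \<le> (a + 1) * t" using d(2) by (intro mult_le_mono) auto
    then show False using t by simp
  qed
  then consider "t = 1" | "t = 2" using t by linarith
  then show ?thesis
  proof cases
    case 1
    then have "r = 1" using d card_divisors_eq_1_iff t_def by auto
    then have m: "m = p ^ a" "card {d. d dvd m} = a + 1" using d 1 t_def by auto
    have "a \<le> 4" using t 1 by simp
    then consider "a = 1" | "a = 2" | "a = 3" | "a = 4" using d(2) by linarith
    then show ?thesis using m d(1) by cases (use prime square cube fourth in auto)
  next
    case 2
    then have "prime r" using card_divisors_eq_2[of r] d(4) t_def by simp
    have "a = 1" using t 2 d(2) by simp
    then have m: "m = p * r" "card {d. d dvd m} = 4" using d 2 t_def by auto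
    have "p \<noteq> r" using d(3) by auto
    then consider "p < r" | "r < p" by linarith
    then show ?thesis using m \<open>prime r\<close> d(1) semiprime by cases (auto simp: mult.commute)
  qed
qed

lemma card_divisors_eq_7:
  fixes n :: nat
  assumes "card {d. d dvd n} = 7" "n > 0"
  shows "\<exists>p. prime p \<and> n = p ^ 6"
proof -
  have "n > 1" using assms card_divisors_eq_1_iff[of n] by (cases "n = 1") auto
  then obtain p a r where d: "prime p" "a > 0" "\<not> p dvd r" "r > 0" "n = p ^ a * r"
    "card {d. d dvd n} = (a + 1) * card {d. d dvd r}" "card {d. d dvd r} > 0"
    using prime_power_mult_decomp by metis
  have "a + 1 dvd 7" using d assms by (metis dvd_triv_left)
  moreover have "prime (7::nat)" by simp
  ultimately have "a + 1 = 1 \<or> a + 1 = 7" unfolding prime_nat_iff by blast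
  then have "a = 6" using d(2) by simp
  then have "r = 1" using d(4,6) assms card_divisors_eq_1_iff[of r] by simp
  then show ?thesis using d(1,5) \<open>a = 6\<close> by auto
qed

lemma prime_le_4_cases:
  fixes p :: nat
  assumes "prime p" "p \<le> 4"
  shows "p = 2 \<or> p = 3"
proof -
  have "p \<noteq> 4" using assms(1) by (intro notI) simp
  then show ?thesis using assms(2) prime_ge_2_nat[OF assms(1)] by linarith
qed

text \<open>Properness is expressed by \<open>2 * d\<close> because it is derived from
  \<open>j * d \<le> ord x\<close> with \<open>j \<ge> 2\<close>. Among the powers of
  \<open>p\<close> only the top one violates it.\<close>

lemma proper_divisor_prime_power:
  fixes p :: nat
  assumes p: "prime p" and d: "d dvd p ^ Suc a" "2 * d \<le> p ^ Suc a"
  shows "d dvd p ^ a"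
proof -
  obtain i where i: "i \<le> Suc a" "d = p ^ i" using d(1) divides_primepow_nat[OF p] by blast
  have "p ^ Suc a > 0" using p by (simp add: prime_gt_0_nat)
  then have "i \<noteq> Suc a" using d(2) i(2) by (intro notI) simp
  then show ?thesis using i by (auto intro: le_imp_power_dvd)
qed

section \<open>Cyclic subgroups and element orders\<close>

context group
begin

lemma mem_generate_singleton_iff:
  assumes "finite (carrier G)" "x \<in> carrier G"
  shows "y \<in> generate G {x} \<longleftrightarrow> (\<exists>k::nat. y = x [^] k)"
  using generate_pow_on_finite_carrier[OF assms] by auto

lemma generate_singleton_eq_powers:
  assumes "finite (carrier G)" "x \<in> carrier G" "ord x = m"
  shows "generate G {x} = (\<lambda>i. x [^] i) ` {..<m}"
proof -
  have "m > 0" using ord_ge_1[OF assms(1,2)] assms(3) by simp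
  then have "{0..ord x - 1} = {..<m}" using assms(3) by auto
  then show ?thesis
    using generate_pow_on_finite_carrier[OF assms(1,2)] ord_elems[OF assms(1,2)] by auto
qed

lemma generate_singleton_subset:
  assumes "x \<in> carrier G" "y \<in> generate G {x}"
  shows "generate G {y} \<subseteq> generate G {x}"
  using assms by (intro generate_subgroup_incl generate_is_subgroup) auto

lemma generate_singleton_in_carrier: "x \<in> carrier G \<Longrightarrow> generate G {x} \<subseteq> carrier G"
  by (intro generate_incl) auto

lemma in_generate_singleton: "x \<in> generate G {x}"
  by (simp add: generate.incl)

lemma generate_singleton_eqI:
  assumes "finite (carrier G)" "x \<in> carrier G" "y \<in> generate G {x}" "ord y = ord x"
  shows "generate G {y} = generate G {x}"
proof (rule card_subset_eq)
  have "y \<in> carrier G" using generate_singleton_in_carrier assms by auto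
  then show "card (generate G {y}) = card (generate G {x})"
    using assms by (simp flip: generate_pow_card)
  show "finite (generate G {x})"
    using finite_subset[OF generate_singleton_in_carrier] assms by auto
  show "generate G {y} \<subseteq> generate G {x}" using assms generate_singleton_subset by blast
qed

text \<open>The definition asks for cyclicity of the restricted structure. Powers there agree with
  powers in \<open>G\<close>, so cyclic subgroups become the values of a map on elements, which is
  the form needed for counting generators.\<close>

lemma cyclic_subgroups_eq: "cyclic_subgroups G = (\<lambda>x. generate G {x}) ` carrier G"
proof (intro equalityI subsetI)
  fix H assume H: "H \<in> cyclic_subgroups G"
  then have sub: "subgroup H G" by (simp add: cyclic_subgroups_def)
  interpret H: group "G\<lparr>carrier := H\<rparr>" using subgroup_imp_group[OF sub] .
  obtain x where x: "x \<in> H" "H = range (\<lambda>n::int. x [^]\<^bsub>G\<lparr>carrier := H\<rparr>\<^esub> n)"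
    using H H.cyclic_group by (auto simp: cyclic_subgroups_def)
  have "H = range (\<lambda>n::int. x [^] n)"
    using x int_pow_consistent[OF sub x(1)] by simp
  also have "\<dots> = generate G {x}"
    using subgroup.mem_carrier[OF sub x(1)] by (auto simp: generate_pow)
  finally show "H \<in> (\<lambda>x. generate G {x}) ` carrier G"
    using subgroup.mem_carrier[OF sub x(1)] by blast
next
  fix H assume "H \<in> (\<lambda>x. generate G {x}) ` carrier G"
  then obtain x where x: "x \<in> carrier G" "H = generate G {x}" by blast
  have sub: "subgroup H G" using x by (simp add: generate_is_subgroup)
  interpret H: group "G\<lparr>carrier := H\<rparr>" using subgroup_imp_group[OF sub] .
  have xH: "x \<in> H" using x in_generate_singleton by simp
  have "H = range (\<lambda>n::int. x [^] n)" using x by (auto simp: generate_pow)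
  then have "H = range (\<lambda>n::int. x [^]\<^bsub>G\<lparr>carrier := H\<rparr>\<^esub> n)"
    using int_pow_consistent[OF sub xH] by simp
  then have "cyclic_group (G\<lparr>carrier := H\<rparr>)" using xH H.cyclic_group by auto
  then show "H \<in> cyclic_subgroups G" using sub by (simp add: cyclic_subgroups_def)
qed

lemma card_generators:
  assumes fin: "finite (carrier G)" and x: "x \<in> carrier G"
  shows "card {y \<in> carrier G. generate G {y} = generate G {x}} = totient (ord x)"
proof -
  have "{y \<in> carrier G. generate G {y} = generate G {x}} = (\<lambda>k. x [^] k) ` totatives (ord x)"
  proof (intro equalityI subsetI)
    fix y assume y: "y \<in> {y \<in> carrier G. generate G {y} = generate G {x}}"
    then have "y \<in> generate G {x}" using in_generate_singleton by blast
    then obtain k :: nat where k: "y = x [^] k"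
      using mem_generate_singleton_iff fin x by blast
    have op: "ord x > 0" using ord_ge_1[OF fin x] by simp
    \<comment> \<open>\<open>totatives\<close> uses the representatives
      \<open>1, ..., ord x\<close>, so the residue \<open>0\<close> is represented by
      \<open>ord x\<close>; this covers \<open>ord x = 1\<close>.\<close>
    define l where "l = (if k mod ord x = 0 then ord x else k mod ord x)"
    have l: "l \<in> {0<..ord x}" using op by (auto simp: l_def intro: less_imp_le)
    have "x [^] l = x [^] (k mod ord x)" using x by (simp add: l_def)
    also have "\<dots> = x [^] (k mod ord x) \<otimes> (x [^] ord x) [^] (k div ord x)" using x by simp
    also have "\<dots> = x [^] k" using x by (simp add: nat_pow_pow nat_pow_mult del: pow_ord_eq_1)
    finally have yl: "y = x [^] l" using k by simp
    have "ord y = ord x" using y x generate_pow_card by auto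
    then have "coprime l (ord x)" using pow_ord_eq_ord_iff fin x yl by blast
    then show "y \<in> (\<lambda>k. x [^] k) ` totatives (ord x)" using l yl by (auto simp: totatives_def)
  next
    fix y assume "y \<in> (\<lambda>k. x [^] k) ` totatives (ord x)"
    then obtain k where k: "y = x [^] k" "coprime k (ord x)" by (auto simp: totatives_def)
    then have "ord y = ord x" using pow_ord_eq_ord_iff fin x by blast
    moreover have "y \<in> generate G {x}" using k mem_generate_singleton_iff fin x by blast
    ultimately show "y \<in> {y \<in> carrier G. generate G {y} = generate G {x}}"
      using generate_singleton_eqI fin x k by auto
  qed
  moreover have "inj_on (\<lambda>k. x [^] k) (totatives (ord x))"
    using ord_inj'[OF x] by (rule inj_on_subset) (auto simp: totatives_def)
  ultimately show ?thesis by (simp add: card_image totient_def)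
qed

lemma generate_singleton_in_subgroup_iff:
  "subgroup M G \<Longrightarrow> generate G {y} \<subseteq> M \<longleftrightarrow> y \<in> M"
  using generate_subgroup_incl[of "{y}" M] in_generate_singleton by blast

text \<open>The elements outside \<open>M\<close> are partitioned by the cyclic subgroup they
  generate. If one generator of \<open>H\<close> is outside \<open>M\<close>, all are, so the class
  of \<open>H\<close> has \<open>totient (card H)\<close> elements.\<close>

lemma sum_totient_cyclic_outside:
  assumes fin: "finite (carrier G)" and M: "subgroup M G"
  shows "(\<Sum>H | H \<in> cyclic_subgroups G \<and> \<not> H \<subseteq> M. totient (card H)) = order G - card M"
proof -
  let ?O = "{H. H \<in> cyclic_subgroups G \<and> \<not> H \<subseteq> M}"
  let ?F = "\<lambda>H. {y \<in> carrier G. generate G {y} = H}"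
  have MG: "M \<subseteq> carrier G" using M subgroup.subset by blast
  have "order G - card M = card (carrier G - M)"
    unfolding order_def using fin MG by (simp add: card_Diff_subset finite_subset)
  also have "carrier G - M = (\<Union>H\<in>?O. ?F H)"
    using generate_singleton_in_subgroup_iff[OF M] by (auto simp: cyclic_subgroups_eq)
  also have "card \<dots> = (\<Sum>H\<in>?O. card (?F H))"
    using fin by (intro card_UN_disjoint) (auto simp: cyclic_subgroups_eq)
  also have "\<dots> = (\<Sum>H\<in>?O. totient (card H))"
    by (intro sum.cong refl)
       (auto simp: cyclic_subgroups_eq card_generators fin simp flip: generate_pow_card)
  finally show ?thesis by simp
qed

text \<open>\<open>card\<close> itself is the bijection onto the divisors. It is injective because a
  subgroup of order \<open>e\<close> of \<open>\<langle>x\<rangle>\<close> can only be the one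
  generated by \<open>x [^] (ord x div e)\<close>.\<close>

lemma card_cyclic_subgroups_inside:
  assumes fin: "finite (carrier G)" and x: "x \<in> carrier G"
  shows "card {H \<in> cyclic_subgroups G. H \<subseteq> generate G {x}} = card {d. d dvd ord x}"
proof (rule bij_betw_same_card[of card])
  let ?m = "ord x"
  have op: "?m > 0" using ord_ge_1[OF fin x] by simp
  have pw: "x [^] k \<in> generate G {x}" for k :: nat using mem_generate_singleton_iff fin x by blast
  show "bij_betw card {H \<in> cyclic_subgroups G. H \<subseteq> generate G {x}} {d. d dvd ?m}"
  proof (rule bij_betw_imageI)
    have *: "ord y dvd ?m \<and> generate G {y} = generate G {x [^] (?m div ord y)}"
      if y: "y \<in> carrier G" "generate G {y} \<subseteq> generate G {x}" for y
    proof -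
      have "y \<in> generate G {x}" using y in_generate_singleton by blast
      then obtain k :: nat where k: "y = x [^] k" using mem_generate_singleton_iff fin x by blast
      have oy: "ord y = ?m div gcd ?m k"
        using op by (cases "k = 0") (simp_all add: k ord_pow_gen x)
      let ?g = "gcd ?m k"
      have g: "?m div ord y = ?g" using oy op by (simp add: dvd_div_eq_mult div_div_eq_right)
      have oz: "ord (x [^] ?g) = ord y"
        using oy op x by (simp add: ord_pow_gen)
      have "k = ?g * (k div ?g)" by simp
      then have "y = (x [^] ?g) [^] (k div ?g)" using k x by (simp add: nat_pow_pow)
      then have "y \<in> generate G {x [^] ?g}" using mem_generate_singleton_iff fin x by blast
      then have "generate G {y} = generate G {x [^] ?g}"
        using generate_singleton_eqI fin x oz by simp
      moreover have "ord y dvd ?m" using oy by (metis dvd_triv_left dvd_div_mult_self gcd_dvd1)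
      ultimately show ?thesis using g by simp
    qed
    show "inj_on card {H \<in> cyclic_subgroups G. H \<subseteq> generate G {x}}"
    proof (rule inj_onI)
      fix H K assume H: "H \<in> {H \<in> cyclic_subgroups G. H \<subseteq> generate G {x}}"
        and K: "K \<in> {H \<in> cyclic_subgroups G. H \<subseteq> generate G {x}}" and eq: "card H = card K"
      obtain y z where "y \<in> carrier G" "z \<in> carrier G" "H = generate G {y}" "K = generate G {z}"
        using H K by (auto simp: cyclic_subgroups_eq)
      then show "H = K" using *[of y] *[of z] H K eq generate_pow_card by auto
    qed
    show "card ` {H \<in> cyclic_subgroups G. H \<subseteq> generate G {x}} = {d. d dvd ?m}"
    proof (intro equalityI subsetI)
      fix d assume "d \<in> card ` {H \<in> cyclic_subgroups G. H \<subseteq> generate G {x}}"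
      then show "d \<in> {d. d dvd ?m}" using * generate_pow_card by (auto simp: cyclic_subgroups_eq)
    next
      fix d assume "d \<in> {d. d dvd ?m}"
      then have d: "d dvd ?m" by simp
      then obtain e where e: "?m = d * e" by (auto elim: dvdE)
      then have "?m div d = e" "e > 0" "d > 0" using op by auto
      then have "ord (x [^] (?m div d)) = d" using ord_pow[OF x, of e] e by simp
      then have "card (generate G {x [^] (?m div d)}) = d" using generate_pow_card x by simp
      then show "d \<in> card ` {H \<in> cyclic_subgroups G. H \<subseteq> generate G {x}}"
        using x generate_singleton_subset[OF x pw]
        by (intro image_eqI[of _ _ "generate G {x [^] (?m div d)}"]) (auto simp: cyclic_subgroups_eq)
    qed
  qed
qed

lemma finite_cyclic_subgroups: "finite (carrier G) \<Longrightarrow> finite (cyclic_subgroups G)"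
  by (simp add: cyclic_subgroups_eq)

lemma card_cyclic_subgroups_outside:
  assumes fin: "finite (carrier G)" and x: "x \<in> carrier G"
  shows "card {H \<in> cyclic_subgroups G. \<not> H \<subseteq> generate G {x}} + card {d. d dvd ord x}
    = card (cyclic_subgroups G)"
proof -
  have "cyclic_subgroups G = {H \<in> cyclic_subgroups G. \<not> H \<subseteq> generate G {x}} \<union>
      {H \<in> cyclic_subgroups G. H \<subseteq> generate G {x}}" by auto
  also have "card \<dots> = card {H \<in> cyclic_subgroups G. \<not> H \<subseteq> generate G {x}} +
      card {H \<in> cyclic_subgroups G. H \<subseteq> generate G {x}}"
    using finite_cyclic_subgroups[OF fin] by (intro card_Un_disjoint) auto
  finally show ?thesis using card_cyclic_subgroups_inside[OF assms] by simp
qed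

section \<open>Cyclic subgroups of small index\<close>

lemma inv_mult_cancel: "a \<in> carrier G \<Longrightarrow> b \<in> carrier G \<Longrightarrow> inv a \<otimes> (a \<otimes> b) = b"
  by (simp flip: m_assoc)

lemma mult_inv_cancel: "a \<in> carrier G \<Longrightarrow> b \<in> carrier G \<Longrightarrow> a \<otimes> (inv a \<otimes> b) = b"
  by (simp flip: m_assoc)

lemmas group_simps = m_assoc inv_mult_group inv_mult_cancel mult_inv_cancel

lemma pow_eq_pow_iff:
  assumes "x \<in> carrier G"
  shows "x [^] (m::nat) = x [^] n \<longleftrightarrow> [m = n] (mod ord x)"
proof -
  have "x [^] m = x [^] n \<longleftrightarrow> x [^] int m = x [^] int n" by (simp only: int_pow_int)
  also have "\<dots> \<longleftrightarrow> [int n = int m] (mod int (ord x))"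
    using int_pow_eq[OF assms] by (simp add: cong_iff_dvd_diff)
  finally show ?thesis by (simp add: cong_int_iff cong_sym_eq)
qed

lemma ord_conj:
  assumes "x \<in> carrier G" "g \<in> carrier G"
  shows "ord (g \<otimes> x \<otimes> inv g) = ord x"
    and "(g \<otimes> x \<otimes> inv g) [^] (n::nat) = g \<otimes> x [^] n \<otimes> inv g"
proof -
  show *: "(g \<otimes> x \<otimes> inv g) [^] n = g \<otimes> x [^] n \<otimes> inv g" for n :: nat
    by (induction n) (simp_all add: assms group_simps)
  have "(g \<otimes> x \<otimes> inv g) [^] n = \<one> \<longleftrightarrow> x [^] n = \<one>" for n :: nat
  proof
    assume "(g \<otimes> x \<otimes> inv g) [^] n = \<one>"
    then have "inv g \<otimes> (g \<otimes> x [^] n \<otimes> inv g) \<otimes> g = \<one>" using * assms by simp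
    then show "x [^] n = \<one>" using assms by (simp add: group_simps)
  qed (simp add: * assms)
  then show "ord (g \<otimes> x \<otimes> inv g) = ord x"
    using ord_unique pow_eq_id assms by simp
qed

section \<open>Pigeonhole arguments on cosets\<close>

text \<open>If the left cosets \<open>c i M\<close> were pairwise disjoint, their union would have
  \<open>card I * card M\<close> elements.\<close>

lemma ex_same_left_coset:
  assumes fin: "finite (carrier G)" and M: "subgroup M G"
    and c: "\<And>i. i \<in> I \<Longrightarrow> c i \<in> carrier G"
    and card: "card (\<Union>i\<in>I. (\<lambda>h. c i \<otimes> h) ` M) < card I * card M"
  obtains i j where "i \<in> I" "j \<in> I" "i \<noteq> j" "inv (c i) \<otimes> c j \<in> M"
proof -
  have MG: "\<And>h. h \<in> M \<Longrightarrow> h \<in> carrier G" using M subgroup.mem_carrier by metis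
  let ?f = "\<lambda>(i, h). c i \<otimes> h"
  have "?f ` (I \<times> M) = (\<Union>i\<in>I. (\<lambda>h. c i \<otimes> h) ` M)" by auto
  then have "\<not> inj_on ?f (I \<times> M)"
    using card card_image[of ?f "I \<times> M"] by (auto simp: card_cartesian_product)
  then obtain i h j h' where *: "i \<in> I" "j \<in> I" "h \<in> M" "h' \<in> M" "c i \<otimes> h = c j \<otimes> h'"
    "(i, h) \<noteq> (j, h')" by (auto simp: inj_on_def)
  have G: "c i \<in> carrier G" "c j \<in> carrier G" "h \<in> carrier G" "h' \<in> carrier G" using * MG c by auto
  have "i \<noteq> j" using * G by auto
  moreover have "inv (c i) \<otimes> c j = h \<otimes> inv h'"
  proof -
    have "c j = c i \<otimes> h \<otimes> inv h'" using * G by (simp add: group_simps)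
    then show ?thesis using G by (simp add: group_simps)
  qed
  then have "inv (c i) \<otimes> c j \<in> M" using * M by (simp add: subgroup.m_closed subgroup.m_inv_closed)
  ultimately show ?thesis using that * by blast
qed

lemma inv_pow_mult_pow:
  assumes "x \<in> carrier G" "i \<le> (j::nat)"
  shows "inv (x [^] i) \<otimes> x [^] j = x [^] (j - i)"
proof -
  have "x [^] j = x [^] i \<otimes> x [^] (j - i)" using assms by (simp add: nat_pow_mult)
  then show ?thesis using assms by (simp add: inv_solve_left')
qed

text \<open>The \<open>k + 1\<close> powers \<open>g^0, ..., g^k\<close> meet only \<open>k\<close>
  left cosets of \<open>M\<close>; two powers in the same coset differ by some \<open>g^t\<close> in
  \<open>M\<close>.\<close>

lemma ex_pow_mem_subgroup:
  assumes fin: "finite (carrier G)" and M: "subgroup M G" and ord: "order G = k * card M"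
    and g: "g \<in> carrier G"
  obtains t :: nat where "0 < t" "t \<le> k" "g [^] t \<in> M"
proof -
  have Mpos: "card M > 0" using M fin by (metis card_gt_0_iff finite_subset subgroup.subset subgroup.one_closed empty_iff)
  have "card (\<Union>i\<in>{..k}. (\<lambda>h. g [^] i \<otimes> h) ` M) \<le> order G"
    unfolding order_def using fin g subgroup.mem_carrier[OF M] by (intro card_mono) auto
  also have "\<dots> < card {..k} * card M" using ord Mpos by simp
  finally obtain i j where ij: "i \<le> k" "j \<le> k" "i \<noteq> j" "inv (g [^] i) \<otimes> g [^] j \<in> M"
    using ex_same_left_coset[OF fin M, of "{..k}" "\<lambda>i. g [^] i"] g by auto
  consider "i < j" | "j < i" using ij(3) by linarith
  then show ?thesis
  proof cases
    case 1
    then show ?thesis using that[of "j - i"] ij inv_pow_mult_pow[OF g, of i j] by auto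
  next
    case 2
    have "inv (inv (g [^] i) \<otimes> g [^] j) \<in> M" using ij(4) M subgroup.m_inv_closed by metis
    then have "inv (g [^] j) \<otimes> g [^] i \<in> M" using g by (simp add: inv_mult_group)
    then show ?thesis using that[of "i - j"] 2 ij inv_pow_mult_pow[OF g, of j i] by auto
  qed
qed

lemma mem_subgroup_if_coprime_pow:
  assumes fin: "finite (carrier G)" and M: "subgroup M G" and g: "g \<in> carrier G"
    and t: "g [^] t \<in> M" "coprime (t::nat) (ord g)"
  shows "g \<in> M"
proof -
  have "generate G {g [^] t} = generate G {g}"
    using generate_singleton_eqI[OF fin g] pow_ord_eq_ord_iff[OF fin g] t
      mem_generate_singleton_iff[OF fin g] by blast
  moreover have "generate G {g [^] t} \<subseteq> M" using generate_singleton_in_subgroup_iff[OF M] t by blast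
  ultimately show ?thesis using in_generate_singleton by blast
qed

text \<open>With \<open>t \<le> k\<close> and \<open>g^t\<close> in
  \<open>\<langle>x\<rangle>\<close>, take \<open>j = gcd (ord g) t\<close> and
  \<open>d = ord (g^t)\<close>. For \<open>j = 1\<close> the power \<open>g^t\<close> would generate
  \<open>\<langle>g\<rangle>\<close> and put \<open>g\<close> into
  \<open>\<langle>x\<rangle>\<close>.\<close>

lemma ord_outside_cyclic:
  assumes fin: "finite (carrier G)" and x: "x \<in> carrier G" and k: "order G = k * ord x"
    and g: "g \<in> carrier G" "g \<notin> generate G {x}"
  obtains j d where "2 \<le> j" "j \<le> k" "d dvd ord x" "ord g = j * d"
proof -
  have M: "subgroup (generate G {x}) G" using x by (simp add: generate_is_subgroup)
  obtain t where t: "0 < t" "t \<le> k" "g [^] t \<in> generate G {x}"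
    using ex_pow_mem_subgroup[OF fin M _ g(1)] k generate_pow_card[OF x] by metis
  obtain i :: nat where i: "g [^] t = x [^] i" using t(3) mem_generate_singleton_iff[OF fin x] by blast
  let ?j = "gcd (ord g) t"
  have "ord (g [^] t) dvd ord x"
    using x i by (metis nat_pow_closed nat_pow_pow pow_eq_id pow_ord_eq_1 mult.commute nat_pow_one)
  moreover have "ord g = ?j * ord (g [^] t)" using t(1) by (simp add: ord_pow_gen g)
  moreover have "?j \<le> k" using order_trans[OF gcd_le2_nat t(2)] t(1) by simp
  moreover have "?j \<noteq> 1"
    using mem_subgroup_if_coprime_pow[OF fin M g(1) t(3)] g(2) by (metis coprime_iff_gcd_eq_1 gcd.commute)
  moreover have "?j > 0" using t(1) by simp
  ultimately show ?thesis using that[of ?j] by (metis One_nat_def Suc_1 Suc_leI le_neq_implies_less)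
qed

text \<open>
  If \<open>g \<notin> \<langle>x\<rangle>\<close>, the \<open>p * ord x\<close> products \<open>x^i g h\<close> with \<open>i < p\<close> and \<open>h \<in> \<langle>x\<rangle>\<close> all miss \<open>\<one>\<close>, so two of
  them coincide, and some \<open>x^t\<close> with \<open>0 < t < p\<close> is conjugated into \<open>\<langle>x\<rangle>\<close> by \<open>g\<close>.
\<close>

lemma conj_mem_cyclic:
  assumes fin: "finite (carrier G)" and x: "x \<in> carrier G" and p: "order G = p * ord x"
    and cop: "\<And>t. 0 < t \<Longrightarrow> t < p \<Longrightarrow> coprime t (ord x)"
    and g: "g \<in> carrier G"
  shows "inv g \<otimes> x \<otimes> g \<in> generate G {x}"
proof (cases "g \<in> generate G {x}")
  case True
  have M: "subgroup (generate G {x}) G" using x by (simp add: generate_is_subgroup)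
  show ?thesis using True in_generate_singleton M
    by (simp add: subgroup.m_closed subgroup.m_inv_closed)
next
  case False
  let ?M = "generate G {x}"
  have M: "subgroup ?M G" using x by (simp add: generate_is_subgroup)
  have xi: "x [^] (i::nat) \<in> ?M" for i using mem_generate_singleton_iff[OF fin x] by blast
  have MG: "h \<in> carrier G" if "h \<in> ?M" for h using subgroup.mem_carrier[OF M that] .
  let ?U = "\<Union>i\<in>{..<p}. (\<lambda>h. x [^] i \<otimes> g \<otimes> h) ` ?M"
  have "\<one> \<notin> ?U"
  proof
    assume "\<one> \<in> ?U"
    then obtain i :: nat and h where h: "h \<in> ?M" "\<one> = x [^] i \<otimes> g \<otimes> h"
      unfolding UN_iff image_iff by blast
    then have "g = inv (x [^] i) \<otimes> inv h"
    proof -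
      have "x [^] i \<otimes> g = inv h" using h(2) x g MG[OF h(1)] by (metis inv_equality m_closed nat_pow_closed)
      then have "inv (x [^] i) \<otimes> (x [^] i \<otimes> g) = inv (x [^] i) \<otimes> inv h" by simp
      then show ?thesis using x g by (simp add: inv_mult_cancel)
    qed
    then show False using False xi h M by (simp add: subgroup.m_closed subgroup.m_inv_closed)
  qed
  moreover have "?U \<subseteq> carrier G" using x g MG by auto
  ultimately have "card ?U < card (carrier G)"
    using fin one_closed by (metis psubsetI psubset_card_mono)
  also have "\<dots> = card {..<p} * card ?M" using p generate_pow_card[OF x] by (simp add: order_def)
  finally obtain i j where ij: "i < p" "j < p" "i \<noteq> j" "inv (x [^] i \<otimes> g) \<otimes> (x [^] j \<otimes> g) \<in> ?M"
    using ex_same_left_coset[OF fin M, of "{..<p}" "\<lambda>i. x [^] i \<otimes> g"] x g by auto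
  have *: "inv g \<otimes> x [^] (b - a) \<otimes> g \<in> ?M"
    if "inv (x [^] a \<otimes> g) \<otimes> (x [^] b \<otimes> g) \<in> ?M" "a < b" for a b :: nat
  proof -
    have "inv (x [^] a \<otimes> g) \<otimes> (x [^] b \<otimes> g) = inv g \<otimes> (inv (x [^] a) \<otimes> x [^] b) \<otimes> g"
      using x g by (simp add: inv_mult_group m_assoc)
    then show ?thesis using that inv_pow_mult_pow[OF x, of a b] by simp
  qed
  have **: "inv (x [^] j \<otimes> g) \<otimes> (x [^] i \<otimes> g) \<in> ?M"
  proof -
    have "inv (inv (x [^] i \<otimes> g) \<otimes> (x [^] j \<otimes> g)) \<in> ?M"
      using ij(4) M subgroup.m_inv_closed by metis
    then show ?thesis using x g by (simp add: inv_mult_group m_assoc)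
  qed
  obtain t where t: "0 < t" "t < p" "inv g \<otimes> x [^] (t::nat) \<otimes> g \<in> ?M"
  proof (cases "i < j")
    case True
    then show ?thesis using that[of "j - i"] *[OF ij(4)] ij by auto
  next
    case False
    then show ?thesis using that[of "i - j"] *[OF **] ij by auto
  qed
  define y where "y = inv g \<otimes> x \<otimes> g"
  have y: "y \<in> carrier G" using x g by (simp add: y_def)
  have yp: "y [^] n = inv g \<otimes> x [^] n \<otimes> g" for n :: nat
    using ord_conj(2)[OF x, of "inv g"] g by (simp add: y_def)
  have "ord y = ord x" using ord_conj(1)[OF x, of "inv g"] g by (simp add: y_def)
  \<comment> \<open>Since \<open>t\<close> is coprime to the common order of \<open>x\<close> and
    \<open>y\<close>, the element \<open>y\<close> is a power of \<open>y^t\<close> and follows it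
    into \<open>\<langle>x\<rangle>\<close>.\<close>
  then show ?thesis
    using mem_subgroup_if_coprime_pow[OF fin M y, of t] t cop yp y_def by simp
qed

section \<open>Orders of products, and elements of prime order\<close>

text \<open>The exponent \<open>?n * ord b\<close> kills both \<open>a b\<close> and
  \<open>b\<close>, hence \<open>a\<close>; so \<open>ord a\<close> divides
  \<open>?n * ord b\<close>, and \<open>?n\<close> by coprimality.\<close>

lemma ord_mult_coprime:
  assumes xy: "x \<in> carrier G" "y \<in> carrier G" "x \<otimes> y = y \<otimes> x" and cop: "coprime (ord x) (ord y)"
  shows "ord (x \<otimes> y) = ord x * ord y"
proof (rule dvd_antisym)
  show "ord (x \<otimes> y) dvd ord x * ord y" using xy by (intro ord_mul_divides)
  let ?n = "ord (x \<otimes> y)"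
  have *: "ord a dvd ?n" if ab: "a \<in> carrier G" "b \<in> carrier G" "a \<otimes> b = b \<otimes> a" "x \<otimes> y = a \<otimes> b"
    "coprime (ord a) (ord b)" for a b
  proof -
    have "a [^] (?n * ord b) \<otimes> b [^] (?n * ord b) = (a \<otimes> b) [^] (?n * ord b)"
      using pow_mult_distrib[OF ab(3,1,2)] by simp
    also have "\<dots> = ((x \<otimes> y) [^] ?n) [^] ord b" using ab(1,2) by (simp add: ab(4) nat_pow_pow del: pow_ord_eq_1)
    also have "\<dots> = \<one>" using xy by simp
    finally have "a [^] (?n * ord b) \<otimes> b [^] (?n * ord b) = \<one>" .
    moreover have "b [^] (?n * ord b) = \<one>" using ab by (simp add: pow_eq_id)
    ultimately have "a [^] (?n * ord b) = \<one>" using ab(1) by simp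
    then have "ord a dvd ?n * ord b" using ab(1) pow_eq_id by blast
    then show ?thesis using ab(5) coprime_dvd_mult_left_iff by blast
  qed
  have "ord x dvd ?n" "ord y dvd ?n" using *[of x y] *[of y x] xy cop by (auto simp: coprime_commute)
  then show "ord x * ord y dvd ?n" using cop by (rule divides_mult)
qed

text \<open>Cauchy's theorem, as Sylow existence for the exponent \<open>1\<close>: a subgroup of
  order \<open>p\<close> is available even if a higher power of \<open>p\<close> divides the group
  order.\<close>

lemma ex_ord_eq_prime:
  assumes fin: "finite (carrier G)" and p: "prime p" "p dvd order G"
  obtains y where "y \<in> carrier G" "ord y = p"
proof -
  obtain m where "order G = p ^ 1 * m" using p(2) by (auto elim: dvdE)
  then obtain H where H: "subgroup H G" "card H = p ^ 1"
    using sylow_thm[OF p(1) is_group _ fin] by blast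
  have "H \<noteq> {\<one>}" using H p(1) by (auto simp: prime_gt_Suc_0_nat)
  then obtain y where y: "y \<in> H" "y \<noteq> \<one>" using subgroup.one_closed[OF H(1)] by blast
  have yG: "y \<in> carrier G" using subgroup.mem_carrier[OF H(1) y(1)] .
  interpret H: group "G\<lparr>carrier := H\<rparr>" using subgroup_imp_group[OF H(1)] .
  have "y [^]\<^bsub>G\<lparr>carrier := H\<rparr>\<^esub> order (G\<lparr>carrier := H\<rparr>) = \<one>" using H.pow_order_eq_1 y(1) by simp
  then have "y [^] p = \<one>" using H(2) by (simp add: order_def flip: nat_pow_consistent)
  then have "ord y dvd p" using yG by (simp add: pow_eq_id)
  then have "ord y = 1 \<or> ord y = p" using p(1) by (simp add: prime_nat_iff)
  then show ?thesis using that[OF yG] y(2) yG ord_eq_1 by blast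
qed

text \<open>A unique involution equals all its conjugates, so it is central, and its product with
  \<open>w\<close> has order \<open>2 * 3\<close>.\<close>

lemma ord_6_if_unique_involution:
  assumes z: "z \<in> carrier G" "ord z = 2"
    and uniq: "\<And>y. y \<in> carrier G \<Longrightarrow> ord y = 2 \<Longrightarrow> y = z"
    and w: "w \<in> carrier G" "ord w = 3"
  shows "ord (z \<otimes> w) = 6"
proof -
  have "w \<otimes> z \<otimes> inv w = z" using uniq[of "w \<otimes> z \<otimes> inv w"] ord_conj(1)[OF z(1) w(1)] z w by simp
  then have "z \<otimes> w = w \<otimes> z" using z w by (metis inv_solve_right m_closed)
  moreover have "coprime (2::nat) 3" by (rule primes_coprime) simp_all
  ultimately show ?thesis using ord_mult_coprime[of z w] z w by simp
qed

text \<open>Conjugation by \<open>y\<close> maps \<open>x\<close> to \<open>x^r\<close>, and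
  \<open>y^3 = 1\<close> gives \<open>r^3 = 1\<close> modulo 5. The unit group modulo 5 has order 4,
  which is coprime to 3, so \<open>r = 1\<close> modulo 5 and \<open>x\<close> commutes with
  \<open>y\<close>.\<close>

lemma ord_15_if_unique_subgroup:
  assumes fin: "finite (carrier G)" and x: "x \<in> carrier G" "ord x = 5"
    and uniq: "\<And>y. y \<in> carrier G \<Longrightarrow> ord y = 5 \<Longrightarrow> y \<in> generate G {x}"
    and y: "y \<in> carrier G" "ord y = 3"
  shows "ord (x \<otimes> y) = 15"
proof -
  have "y \<otimes> x \<otimes> inv y \<in> generate G {x}" using uniq[of "y \<otimes> x \<otimes> inv y"] ord_conj(1)[OF x(1) y(1)] x y by simp
  then obtain r :: nat where r: "y \<otimes> x \<otimes> inv y = x [^] r"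
    using mem_generate_singleton_iff[OF fin x(1)] by blast
  have pw: "y \<otimes> x [^] i \<otimes> inv y = x [^] (r * i)" for i :: nat
    using ord_conj(2)[OF x(1) y(1), of i] r x by (simp add: nat_pow_pow)
  have "y [^] (3::nat) = \<one>" using y pow_ord_eq_1 by metis
  then have y3: "y \<otimes> (y \<otimes> y) = \<one>" using y by (simp add: numeral_3_eq_3 m_assoc)
  then have y3i: "inv y \<otimes> (inv y \<otimes> inv y) = \<one>" using y by (metis inv_closed inv_mult_group inv_one m_assoc m_closed)
  have "y \<otimes> (y \<otimes> (y \<otimes> x \<otimes> inv y) \<otimes> inv y) \<otimes> inv y = (y \<otimes> (y \<otimes> y)) \<otimes> x \<otimes> (inv y \<otimes> (inv y \<otimes> inv y))"
    using x y by (simp add: m_assoc)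
  then have "x [^] (r * (r * r)) = x [^] (1::nat)" using y3 y3i r pw x by simp
  then have "[r * (r * r) = 1] (mod 5)"
    using pow_eq_pow_iff[OF x(1), of "r * (r * r)" 1] x(2) by simp
  moreover have "[(r mod 5) * ((r mod 5) * (r mod 5)) = r * (r * r)] (mod 5)"
    by (intro cong_mult) (simp_all add: cong_def)
  ultimately have "[(r mod 5) * ((r mod 5) * (r mod 5)) = 1] (mod 5)" using cong_trans by blast
  then have cube: "(r mod 5) * ((r mod 5) * (r mod 5)) mod 5 = 1" unfolding cong_def by simp
  have "s = 1" if "s < 5" "s * (s * s) mod 5 = 1" for s :: nat
  proof -
    have "s = 0 \<or> s = 1 \<or> s = 2 \<or> s = 3 \<or> s = 4" using that(1) by linarith
    then show ?thesis using that(2) by (elim disjE) simp_all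
  qed
  from this[OF _ cube] have "r mod 5 = 1" by simp
  then have "x [^] r = x [^] (1::nat)" using pow_eq_pow_iff[OF x(1), of r 1] x(2) by (simp add: cong_def)
  then have "y \<otimes> x \<otimes> inv y = x" using r x by simp
  then have "x \<otimes> y = y \<otimes> x" using x y by (metis inv_solve_right m_closed)
  moreover have "coprime (5::nat) 3" by (rule primes_coprime) simp_all
  ultimately show ?thesis using ord_mult_coprime[of x y] x y by simp
qed

text \<open>
  The element \<open>z\<close> is a generator of \<open>\<langle>y\<rangle>\<close>, adjusted so that \<open>z^p\<close> cancels \<open>x^p\<close>. Then \<open>x z\<close>, corrected
  for \<open>p = 2\<close> by a power of \<open>x^2\<close>, is an element of order \<open>p\<close> outside \<open>\<langle>x\<rangle>\<close>.
\<close>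

lemma ex_complement_inverting_pow:
  assumes fin: "finite (carrier G)" and p: "prime p" and a: "a \<ge> 2"
    and x: "x \<in> carrier G" "ord x = p ^ a" and y: "y \<in> carrier G" "ord y = p ^ a"
    and G: "order G = p * p ^ a" and yx: "y \<notin> generate G {x}"
  obtains z v where "z \<in> carrier G" "z \<notin> generate G {x}" "z [^] p = inv (x [^] p)"
    "z \<otimes> x [^] p = x [^] p \<otimes> z" "z \<otimes> x = x \<otimes> x [^] (p ^ (a - 1) * v :: nat) \<otimes> z"
proof -
  have p1: "p > 1" using p by (rule prime_gt_1_nat)
  have Mx: "subgroup (generate G {x}) G" and My: "subgroup (generate G {y}) G"
    using x y by (simp_all add: generate_is_subgroup)
  have pa: "p ^ a = p * p ^ (a - 1)" using a by (cases a) auto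
  have cop: "coprime t (p ^ a)" if "0 < t" "t < p" for t
  proof -
    have "\<not> p dvd t" using that nat_dvd_not_less by blast
    then show ?thesis using p prime_imp_coprime[of p t] by (simp add: coprime_commute)
  qed
  have "x \<notin> generate G {y}"
    using generate_singleton_eqI[OF fin y(1), of x] x y yx in_generate_singleton by metis
  obtain t where t: "0 < t" "t \<le> p" "x [^] t \<in> generate G {y}"
    using ex_pow_mem_subgroup[OF fin My _ x(1), of p] G y generate_pow_card[OF y(1)] by auto
  \<comment> \<open>A smaller \<open>t\<close> would be coprime to \<open>ord x\<close> and would
    put \<open>x\<close> itself into \<open>\<langle>y\<rangle>\<close>.\<close>
  have "t = p"
  proof (rule ccontr)
    assume "t \<noteq> p"
    then have "coprime t (ord x)" using cop t x by simp
    then show False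
      using mem_subgroup_if_coprime_pow[OF fin My x(1) t(3)] \<open>x \<notin> generate G {y}\<close> by simp
  qed
  then obtain s :: nat where s: "x [^] p = y [^] s"
    using t(3) mem_generate_singleton_iff[OF fin y(1)] by blast
  have "ord (x [^] p) = p ^ (a - 1)" using ord_pow[OF x(1), of p] x p1 pa by simp
  moreover have "ord (y [^] s) * gcd (p ^ a) s = p ^ a"
    using ord_pow_gen[OF y(1), of s] y(2) p1 by (cases "s = 0") auto
  ultimately have "p ^ (a - 1) * gcd (p ^ a) s = p ^ (a - 1) * p" using s pa by (metis mult.commute)
  \<comment> \<open>Comparing the orders of \<open>x^p\<close> and \<open>y^s\<close> shows that
    \<open>p\<close> divides \<open>s\<close> exactly once: \<open>s = p * r\<close> with
    \<open>r\<close> prime to \<open>p\<close>. So \<open>y^r\<close> generates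
    \<open>\<langle>y\<rangle>\<close> and has the same \<open>p\<close>-th power as
    \<open>x\<close>.\<close>
  then have g: "gcd (p ^ a) s = p" using p1 by simp
  then obtain r where r: "s = p * r" by (metis gcd_dvd2 dvdE)
  have "p * gcd (p ^ (a - 1)) r = p * 1"
    using g r pa by (metis gcd_mult_distrib_nat mult.right_neutral)
  then have "coprime (p ^ (a - 1)) r" using p1 by (simp add: coprime_iff_gcd_eq_1)
  then have r_cop: "coprime r (p ^ a)" using a p1 by (auto simp: coprime_commute)
  define z where "z = inv (y [^] r)"
  have z: "z \<in> carrier G" using y by (simp add: z_def)
  have zx: "z \<notin> generate G {x}"
  proof
    assume "z \<in> generate G {x}"
    then have "inv z \<in> generate G {x}" using Mx subgroup.m_inv_closed by metis
    then have "y [^] r \<in> generate G {x}" using y by (simp add: z_def)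
    then show False using mem_subgroup_if_coprime_pow[OF fin Mx y(1)] r_cop y(2) yx by simp
  qed
  have zp: "z [^] p = inv (x [^] p)"
    using y s r by (simp add: z_def nat_pow_inv nat_pow_pow mult.commute)
  have "y [^] r \<otimes> x [^] p = x [^] p \<otimes> y [^] r"
    using y by (simp add: s nat_pow_mult add.commute)
  then have "z \<otimes> (y [^] r \<otimes> x [^] p) \<otimes> z = z \<otimes> (x [^] p \<otimes> y [^] r) \<otimes> z" by simp
  then have zxp: "z \<otimes> x [^] p = x [^] p \<otimes> z"
    using x y by (simp add: z_def group_simps)
  have "inv (inv z) \<otimes> x \<otimes> inv z \<in> generate G {x}"
    using conj_mem_cyclic[OF fin x(1), of p "inv z"] cop G x z by simp
  then obtain u :: nat where u: "z \<otimes> x \<otimes> inv z = x [^] u"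
    using mem_generate_singleton_iff[OF fin x(1)] z by auto
  have "x [^] (u * p) = (z \<otimes> x \<otimes> inv z) [^] p" using u x by (simp add: nat_pow_pow)
  also have "\<dots> = z \<otimes> x [^] p \<otimes> inv z" using ord_conj(2) x z by blast
  also have "\<dots> = x [^] p" using zxp x z by (simp add: group_simps)
  \<comment> \<open>As \<open>z\<close> centralises \<open>x^p\<close>, conjugating \<open>x\<close>
    to \<open>x^u\<close> fixes \<open>x^p\<close>. Cancelling \<open>p\<close> gives
    \<open>u = 1\<close> modulo \<open>p^(a-1)\<close> only, so \<open>x^u\<close> differs from
    \<open>x\<close> by an element of the subgroup of order \<open>p\<close>.\<close>
  finally have "[u * p = 1 * p] (mod p ^ (a - 1) * p)"
    using pow_eq_pow_iff[OF x(1)] x(2) pa by (simp add: mult.commute)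
  then have u1: "[u = 1] (mod p ^ (a - 1))" using p1 by (simp only: cong_mult_rcancel_nat cong_def mod_mult_mult2, simp)
  \<comment> \<open>This makes the natural subtraction in \<open>u - 1\<close> genuine.\<close>
  moreover have "u \<noteq> 0"
  proof
    assume "u = 0"
    then have "p ^ (a - 1) dvd 1" using cong_sym[OF u1] by (simp add: cong_0_iff)
    then show False using p1 a by simp
  qed
  ultimately have "p ^ (a - 1) dvd u - 1" by (simp add: cong_altdef_nat)
  then obtain v where "u - 1 = p ^ (a - 1) * v" by (auto elim: dvdE)
  then have v: "u = 1 + p ^ (a - 1) * v" using \<open>u \<noteq> 0\<close> by simp
  have "z \<otimes> x = (z \<otimes> x \<otimes> inv z) \<otimes> z" using x z by (simp add: group_simps)
  also have "\<dots> = x \<otimes> x [^] (p ^ (a - 1) * v) \<otimes> z"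
    unfolding u v using nat_pow_mult[OF x(1), of 1 "p ^ (a - 1) * v"] x by simp
  finally show ?thesis using that z zx zp zxp by blast
qed

lemma mult_mem_subgroup_iff:
  assumes "subgroup M G" "a \<in> M" "b \<in> carrier G"
  shows "a \<otimes> b \<in> M \<longleftrightarrow> b \<in> M" "b \<otimes> a \<in> M \<longleftrightarrow> b \<in> M"
proof -
  have a: "a \<in> carrier G" using assms subgroup.mem_carrier by metis
  have "b \<in> M" if "a \<otimes> b \<in> M"
  proof -
    have "inv a \<otimes> (a \<otimes> b) \<in> M" using that assms by (simp add: subgroup.m_closed subgroup.m_inv_closed)
    then show ?thesis using a assms by (simp add: inv_mult_cancel)
  qed
  moreover have "b \<in> M" if "b \<otimes> a \<in> M"
  proof -
    have "(b \<otimes> a) \<otimes> inv a \<in> M" using that assms by (simp add: subgroup.m_closed subgroup.m_inv_closed)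
    then show ?thesis using a assms by (simp add: m_assoc)
  qed
  ultimately show "a \<otimes> b \<in> M \<longleftrightarrow> b \<in> M" "b \<otimes> a \<in> M \<longleftrightarrow> b \<in> M"
    using assms subgroup.m_closed by metis+
qed

lemma ord_eq_primeI:
  assumes "x \<in> carrier G" "x [^] p = \<one>" "x \<noteq> \<one>" "prime p"
  shows "ord x = p"
  using assms by (metis One_nat_def ord_eq_1 pow_eq_id prime_nat_iff)

text \<open>Let \<open>z x = x w z\<close> with \<open>w^3 = 1\<close>. Moving every
  \<open>z\<close> in \<open>(x z)^3\<close> to the right produces \<open>0 + 1 + 2 = 3\<close>
  factors \<open>w\<close>, which cancel, and \<open>x^3 z^3 = 1\<close> remains. The condition
  \<open>a \<ge> 2\<close> makes \<open>w\<close> a power of \<open>x^3\<close>, so that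
  \<open>w\<close> commutes with \<open>z\<close>.\<close>

lemma ex_ord_3_outside:
  assumes fin: "finite (carrier G)" and a: "a \<ge> 2"
    and x: "x \<in> carrier G" "ord x = 3 ^ a" and y: "y \<in> carrier G" "ord y = 3 ^ a"
    and G: "order G = 3 * 3 ^ a" and yx: "y \<notin> generate G {x}"
  obtains g where "g \<in> carrier G" "g \<notin> generate G {x}" "ord g = 3"
proof -
  obtain z v where z: "z \<in> carrier G" "z \<notin> generate G {x}" "z [^] (3::nat) = inv (x [^] (3::nat))"
    "z \<otimes> x [^] (3::nat) = x [^] (3::nat) \<otimes> z" "z \<otimes> x = x \<otimes> x [^] (3 ^ (a - 1) * v :: nat) \<otimes> z"
    using ex_complement_inverting_pow[OF fin _ a x y G yx] by auto
  define w where "w = x [^] (3 ^ (a - 1) * v :: nat)"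
  have w: "w \<in> carrier G" using x by (simp add: w_def)
  have zpow: "z \<otimes> (x [^] (3::nat)) [^] n = (x [^] (3::nat)) [^] n \<otimes> z" for n :: nat
    by (induction n) (use x z in \<open>simp_all add: m_assoc\<close>, metis z(4) m_assoc nat_pow_closed x(1) z(1))
  obtain b where "a = b + 2" using a by (metis le_add_diff_inverse2)
  then have "w = (x [^] (3::nat)) [^] (3 ^ b * v)" using x by (simp add: w_def nat_pow_pow mult.assoc)
  then have zw: "z \<otimes> w = w \<otimes> z" using zpow by simp
  have zx: "z \<otimes> x = x \<otimes> (w \<otimes> z)" using z x w by (simp add: w_def m_assoc)
  have wx: "w \<otimes> x = x \<otimes> w" using x nat_pow_comm[OF x(1), of _ 1] by (simp add: w_def)
  have w3: "w \<otimes> (w \<otimes> w) = \<one>"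
  proof -
    have "(3::nat) ^ a = 3 * 3 ^ (a - 1)" using a by (cases a) auto
    then have "w [^] (3::nat) = \<one>" using x by (simp add: w_def nat_pow_pow pow_eq_id mult_ac)
    then show ?thesis using w by (simp add: numeral_3_eq_3 m_assoc)
  qed
  \<comment> \<open>The commutation rules are given a tail \<open>q\<close> so that they rewrite
    inside right-associated products and collect the factors in the order \<open>x\<close>,
    \<open>w\<close>, \<open>z\<close>.\<close>
  have swap: "z \<otimes> (x \<otimes> q) = x \<otimes> (w \<otimes> (z \<otimes> q))" "z \<otimes> (w \<otimes> q) = w \<otimes> (z \<otimes> q)"
    "w \<otimes> (x \<otimes> q) = x \<otimes> (w \<otimes> q)" if "q \<in> carrier G" for q
    using zx zw wx that x z(1) w by (simp_all flip: m_assoc)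
  have "(x \<otimes> z) [^] (3::nat) = x \<otimes> (x \<otimes> (x \<otimes> (w \<otimes> (w \<otimes> w) \<otimes> (z \<otimes> (z \<otimes> z)))))"
    using x z(1) w by (simp add: numeral_3_eq_3 m_assoc zx zw wx swap)
  also have "\<dots> = x [^] (3::nat) \<otimes> z [^] (3::nat)"
    using x z(1) by (simp add: w3 numeral_3_eq_3 m_assoc)
  also have "\<dots> = \<one>" using x z by simp
  finally have g3: "(x \<otimes> z) [^] (3::nat) = \<one>" .
  have M: "subgroup (generate G {x}) G" using x by (simp add: generate_is_subgroup)
  have "x \<otimes> z \<notin> generate G {x}"
    using mult_mem_subgroup_iff(1)[OF M in_generate_singleton z(1)] z(2) by simp
  moreover have "x \<otimes> z \<noteq> \<one>" using calculation subgroup.one_closed[OF M] by metis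
  ultimately show ?thesis using that[of "x \<otimes> z"] ord_eq_primeI[of "x \<otimes> z" 3] g3 x z(1) by simp
qed

text \<open>For \<open>p = 2\<close> the square of \<open>x z\<close> is
  \<open>w = x^(2^(a-1) * v)\<close>, which may differ from \<open>1\<close>. The inverse of a
  square root \<open>d\<close> of \<open>w\<close> repairs this, and \<open>a \<ge> 3\<close> makes
  \<open>d\<close> a power of \<open>x^2\<close>, so that it commutes with \<open>z\<close>. For
  \<open>a = 2\<close> the quaternion group has no involution outside
  \<open>\<langle>x\<rangle>\<close>.\<close>

lemma ex_ord_2_outside:
  assumes fin: "finite (carrier G)" and a: "a \<ge> 3"
    and x: "x \<in> carrier G" "ord x = 2 ^ a" and y: "y \<in> carrier G" "ord y = 2 ^ a"
    and G: "order G = 2 * 2 ^ a" and yx: "y \<notin> generate G {x}"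
  obtains g where "g \<in> carrier G" "g \<notin> generate G {x}" "ord g = 2"
proof -
  have a2: "a \<ge> 2" using a by simp
  obtain z v where z: "z \<in> carrier G" "z \<notin> generate G {x}" "z [^] (2::nat) = inv (x [^] (2::nat))"
    "z \<otimes> x [^] (2::nat) = x [^] (2::nat) \<otimes> z" "z \<otimes> x = x \<otimes> x [^] (2 ^ (a - 1) * v :: nat) \<otimes> z"
    using ex_complement_inverting_pow[OF fin _ a2 x y G yx] by auto
  obtain b where b: "a = b + 3" using a by (metis le_add_diff_inverse2)
  \<comment> \<open>Since \<open>b + 1 = a - 2\<close>, the exponent is half of
    \<open>2^(a-1) * v\<close>.\<close>
  define d where "d = x [^] (2 ^ (b + 1) * v :: nat)"
  have d: "d \<in> carrier G" using x by (simp add: d_def)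
  have zpow: "z \<otimes> (x [^] (2::nat)) [^] n = (x [^] (2::nat)) [^] n \<otimes> z" for n :: nat
    by (induction n) (use x z in \<open>simp_all add: m_assoc\<close>, metis z(4) m_assoc nat_pow_closed x(1) z(1))
  have dp: "d = (x [^] (2::nat)) [^] (2 ^ b * v)" using x by (simp add: d_def nat_pow_pow mult.assoc)
  have zd: "z \<otimes> d = d \<otimes> z" using zpow dp by simp
  have dx: "d \<otimes> x = x \<otimes> d" using x nat_pow_comm[OF x(1), of _ 1] by (simp add: d_def)
  have dd: "d \<otimes> d = x [^] (2 ^ (a - 1) * v)"
    using x b by (simp add: d_def nat_pow_mult mult_ac)
  have "z \<otimes> x = x \<otimes> (d \<otimes> d) \<otimes> z" unfolding dd by (rule z(5))
  then have zx: "z \<otimes> x = x \<otimes> (d \<otimes> (d \<otimes> z))" using z(1) x(1) d by (simp add: m_assoc)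
  have zid: "z \<otimes> inv d = inv d \<otimes> z"
  proof -
    have "inv d \<otimes> (z \<otimes> d) \<otimes> inv d = inv d \<otimes> (d \<otimes> z) \<otimes> inv d" using zd by simp
    then show ?thesis using z(1) d by (simp add: group_simps)
  qed
  have xid: "x \<otimes> inv d = inv d \<otimes> x"
  proof -
    have "inv d \<otimes> (x \<otimes> d) \<otimes> inv d = inv d \<otimes> (d \<otimes> x) \<otimes> inv d" using dx by simp
    then show ?thesis using x(1) d by (simp add: group_simps)
  qed
  have swap: "z \<otimes> (x \<otimes> q) = x \<otimes> (d \<otimes> (d \<otimes> (z \<otimes> q)))" "z \<otimes> (d \<otimes> q) = d \<otimes> (z \<otimes> q)"
    "d \<otimes> (x \<otimes> q) = x \<otimes> (d \<otimes> q)" "z \<otimes> (inv d \<otimes> q) = inv d \<otimes> (z \<otimes> q)"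
    "inv d \<otimes> (x \<otimes> q) = x \<otimes> (inv d \<otimes> q)" if "q \<in> carrier G" for q
    using zx zd dx zid xid that x(1) z(1) d by (simp_all flip: m_assoc)
  define g where "g = x \<otimes> (inv d \<otimes> z)"
  have "g \<otimes> g = x \<otimes> (x \<otimes> (z \<otimes> z))"
    using x(1) z(1) d by (simp add: g_def m_assoc zx swap zd dx mult_inv_cancel inv_mult_cancel)
  also have "\<dots> = x [^] (2::nat) \<otimes> z [^] (2::nat)"
    using x z(1) by (simp add: numeral_2_eq_2 m_assoc)
  also have "\<dots> = \<one>" using x z by simp
  finally have g2: "g [^] (2::nat) = \<one>" using x z(1) d by (simp add: g_def numeral_2_eq_2)
  have M: "subgroup (generate G {x}) G" using x by (simp add: generate_is_subgroup)
  have "d \<in> generate G {x}" using mem_generate_singleton_iff[OF fin x(1)] by (auto simp: d_def)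
  then have "inv d \<in> generate G {x}" using M subgroup.m_inv_closed by metis
  then have "g \<notin> generate G {x}" unfolding g_def
    using mult_mem_subgroup_iff(1)[OF M] in_generate_singleton z(1,2) d by simp
  moreover have "g \<noteq> \<one>" using calculation subgroup.one_closed[OF M] by metis
  ultimately show ?thesis using that[of g] ord_eq_primeI[of g 2] g2 x z(1) d by (simp add: g_def)
qed

section \<open>Counting with a common outside order, involutions and inversion\<close>

text \<open>Every cyclic subgroup not inside \<open>\<langle>x\<rangle>\<close> has the same number
  \<open>totient e\<close> of generators, so the number of these subgroups is a quotient. All counts
  in the listed groups come from this.\<close>

lemma card_cyclic_subgroups_if_ord_outside:
  assumes fin: "finite (carrier G)" and x: "x \<in> carrier G"
    and e: "\<And>g. g \<in> carrier G \<Longrightarrow> g \<notin> generate G {x} \<Longrightarrow> ord g = e" and "e > 0"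
  shows "card (cyclic_subgroups G) = card {d. d dvd ord x} + (order G - ord x) div totient e"
proof -
  let ?O = "{H \<in> cyclic_subgroups G. \<not> H \<subseteq> generate G {x}}"
  have M: "subgroup (generate G {x}) G" using x by (simp add: generate_is_subgroup)
  have "order G - ord x = (\<Sum>H\<in>?O. totient (card H))"
    using sum_totient_cyclic_outside[OF fin M] generate_pow_card[OF x] by simp
  also have "\<dots> = (\<Sum>H\<in>?O. totient e)"
  proof (intro sum.cong refl)
    fix H assume H: "H \<in> ?O"
    then obtain y where y: "y \<in> carrier G" "H = generate G {y}" by (auto simp: cyclic_subgroups_eq)
    then have "y \<notin> generate G {x}" using H generate_singleton_in_subgroup_iff[OF M, of y] by simp
    then show "totient (card H) = totient e" using y e generate_pow_card by metis
  qed
  finally have "order G - ord x = card ?O * totient e" by simp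
  then have "card ?O = (order G - ord x) div totient e" using \<open>e > 0\<close> by simp
  then show ?thesis using card_cyclic_subgroups_outside[OF fin x] by simp
qed

text \<open>An involution \<open>x^i\<close> with \<open>i < ord x\<close> satisfies
  \<open>ord x dvd i * 2\<close>, which leaves only \<open>i = ord x div 2\<close>.\<close>

lemma involution_in_cyclic_unique:
  assumes fin: "finite (carrier G)" and x: "x \<in> carrier G"
    and y: "y \<in> generate G {x}" "ord y = 2" and z: "z \<in> generate G {x}" "ord z = 2"
  shows "y = z"
proof -
  have main: "w = x [^] (ord x div 2)" if w: "w \<in> generate G {x}" "ord w = 2" for w
  proof -
    obtain i where i: "i < ord x" "w = x [^] i" using w(1) generate_singleton_eq_powers[OF fin x] by auto
    have "ord w = 2" "w \<in> carrier G" using w i x by simp_all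
    then have "w [^] (2::nat) = \<one>" "w \<noteq> \<one>" using pow_ord_eq_1[of w] by auto
    then have "ord x dvd i * 2" using i x by (simp add: nat_pow_pow pow_eq_id)
    then obtain c where c: "i * 2 = ord x * c" by (auto elim: dvdE)
    then have "ord x * c < ord x * 2" using i(1) by (simp flip: c)
    then have "c < 2" by simp
    moreover have "c \<noteq> 0" using c i(2) \<open>w \<noteq> \<one>\<close> by (intro notI) simp
    ultimately have "i * 2 = ord x" using c by simp
    then have "ord x div 2 = i" by simp
    then show ?thesis using i(2) by simp
  qed
  show ?thesis using main[OF y] main[OF z] by simp
qed

text \<open>Cancel \<open>y\<close> in \<open>x y x y = y y\<close>. When a group is to be
  recognised, equality of the two squares follows from element orders, and this turns it into the
  defining relation.\<close>

lemma inverts_if_square_eq: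
  assumes x: "x \<in> carrier G" and y: "y \<in> carrier G"
    and "(x \<otimes> y) [^] (2::nat) = y [^] (2::nat)"
  shows "y \<otimes> x = inv x \<otimes> y"
proof -
  have "x \<otimes> y \<otimes> x \<otimes> y = y \<otimes> y" using assms by (simp add: numeral_2_eq_2 m_assoc)
  then have "x \<otimes> y \<otimes> x = y" using x y by simp
  then have "inv x \<otimes> (x \<otimes> (y \<otimes> x)) = inv x \<otimes> y" using x y by (simp add: m_assoc)
  then show ?thesis using x y by (simp add: inv_mult_cancel)
qed

lemma card_cyclic_subgroups_cyclic:
  assumes fin: "finite (carrier G)" and x: "x \<in> carrier G" "ord x = order G"
  shows "card (cyclic_subgroups G) = card {d. d dvd order G}"
proof -
  have "generate G {x} = carrier G"
    using x fin generate_singleton_in_carrier[OF x(1)] generate_pow_card[OF x(1)]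
    by (intro card_subset_eq) (auto simp: order_def)
  \<comment> \<open>No element lies outside \<open>\<langle>x\<rangle> = G\<close>, so the condition
    on orders is vacuous. The value \<open>e = 1\<close> is arbitrary, and the second summand is
    \<open>0\<close>.\<close>
  then have "card (cyclic_subgroups G) = card {d. d dvd ord x} + (order G - ord x) div totient 1"
    by (intro card_cyclic_subgroups_if_ord_outside fin x) auto
  then show ?thesis using x by simp
qed

section \<open>Isomorphism types\<close>

lemma int_pow_mod_ord:
  assumes "x \<in> carrier G"
  shows "x [^] (a mod int (ord x)) = x [^] (a :: int)"
  using assms by (simp add: int_pow_eq dvd_minus_mod)

lemma iso_integer_mod_group:
  assumes fin: "finite (carrier G)" and x: "x \<in> carrier G" "ord x = order G"
  shows "G \<cong> integer_mod_group (order G)"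
proof -
  have op: "order G > 0" using ord_ge_1[OF fin x(1)] x(2) by simp
  let ?f = "\<lambda>i::int. x [^] i" and ?C = "carrier (integer_mod_group (order G))"
  have C: "?C = {0..<int (order G)}" using op by (simp add: carrier_integer_mod_group)
  have "?f \<in> hom (integer_mod_group (order G)) G"
    using x int_pow_mod_ord[OF x(1)] by (intro homI) (auto simp: int_pow_mult)
  moreover have inj: "inj_on ?f ?C"
  proof (rule inj_onI)
    fix i j assume ij: "i \<in> ?C" "j \<in> ?C" "x [^] i = x [^] j"
    then have "int (order G) dvd j - i" using int_pow_eq[OF x(1)] x(2) by simp
    moreover have "\<bar>j - i\<bar> < int (order G)" using ij C by auto
    ultimately show "i = j" by (metis dvd_imp_le_int eq_iff_diff_eq_0 abs_of_nat not_less)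
  qed
  moreover have "?f ` ?C = carrier G"
    using fin x(1) card_image[OF inj] by (intro card_subset_eq) (auto simp: C order_def[symmetric])
  ultimately have "?f \<in> iso (integer_mod_group (order G)) G" by (simp add: iso_def bij_betw_def)
  then have "integer_mod_group (order G) \<cong> G" by (auto simp: is_iso_def)
  then show ?thesis using group.iso_sym[OF group_integer_mod_group] by blast
qed

text \<open>The isomorphism sends \<open>(i, h)\<close> to \<open>x^i y^h\<close>. The function
  \<open>\<phi>\<close> records how \<open>y^h\<close> moves past \<open>x^i\<close>, so direct
  products and inverting semidirect products are treated alike. Injectivity comes from
  \<open>triv\<close>, which says that \<open>\<langle>x\<rangle>\<close> and
  \<open>\<langle>y\<rangle>\<close> meet trivially, and surjectivity from the order.\<close>

lemma iso_if_normal_form: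
  fixes P :: "(int \<times> int) monoid"
  assumes fin: "finite (carrier G)" and P: "group P"
    and x: "x \<in> carrier G" and y: "y \<in> carrier G"
    and triv: "\<And>(i::int) (j::int). x [^] i = y [^] j \<Longrightarrow> x [^] i = \<one>"
    and ord: "order G = ord x * ord y"
    and P_carrier: "carrier P = {0..<int (ord x)} \<times> {0..<int (ord y)}"
    and P_mult: "\<And>i h i' h'. (i, h) \<in> carrier P \<Longrightarrow> (i', h') \<in> carrier P \<Longrightarrow>
      (i, h) \<otimes>\<^bsub>P\<^esub> (i', h') = ((i + \<phi> h i') mod int (ord x), (h + h') mod int (ord y))"
    and comm: "\<And>i h. (i, h) \<in> carrier P \<Longrightarrow> y [^] h \<otimes> x [^] i = x [^] \<phi> h i \<otimes> y [^] h"
  shows "G \<cong> P"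
proof -
  let ?f = "\<lambda>(i::int, h::int). x [^] i \<otimes> y [^] h"
  have "?f \<in> hom P G"
  proof (rule homI)
    fix a b assume ab: "a \<in> carrier P" "b \<in> carrier P"
    obtain i h i' h' where [simp]: "a = (i, h)" "b = (i', h')" by fastforce
    have "?f (a \<otimes>\<^bsub>P\<^esub> b) = x [^] (i + \<phi> h i') \<otimes> y [^] (h + h')"
      using ab P_mult int_pow_mod_ord x y by simp
    also have "\<dots> = x [^] i \<otimes> (x [^] \<phi> h i' \<otimes> y [^] h) \<otimes> y [^] h'"
      using x y by (simp add: int_pow_mult m_assoc)
    also have "x [^] \<phi> h i' \<otimes> y [^] h = y [^] h \<otimes> x [^] i'"
      using comm[of i' h] ab P_carrier by simp
    finally show "?f (a \<otimes>\<^bsub>P\<^esub> b) = ?f a \<otimes> ?f b" using x y by (simp add: m_assoc)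
  qed (use x y in auto)
  moreover have inj: "inj_on ?f (carrier P)"
  proof (rule inj_onI)
    fix a b assume ab: "a \<in> carrier P" "b \<in> carrier P" "?f a = ?f b"
    obtain i h i' h' where [simp]: "a = (i, h)" "b = (i', h')" by fastforce
    have eq: "x [^] i \<otimes> y [^] h = x [^] i' \<otimes> y [^] h'" using ab by simp
    have "x [^] (i - i') = inv (x [^] i') \<otimes> (x [^] i \<otimes> y [^] h) \<otimes> inv (y [^] h)"
      using x y by (simp add: m_assoc) (metis add.commute diff_conv_add_uminus int_pow_mult int_pow_neg)
    also have "\<dots> = y [^] (h' - h)" unfolding eq using x y by (simp add: group_simps int_pow_diff)
    finally have e: "x [^] (i - i') = y [^] (h' - h)" .
    have "x [^] (i - i') = \<one>" using triv[OF e] .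
    then have "int (ord x) dvd i - i'" "int (ord y) dvd h' - h"
      using e int_pow_eq_id[OF x, of "i - i'"] int_pow_eq_id[OF y, of "h' - h"] by simp_all
    moreover have "\<bar>i - i'\<bar> < int (ord x)" "\<bar>h' - h\<bar> < int (ord y)" using ab P_carrier by auto
    ultimately have "i = i'" "h' = h"
      by (metis dvd_imp_le_int eq_iff_diff_eq_0 abs_of_nat not_less)+
    then show "a = b" by simp
  qed
  moreover have "?f ` carrier P = carrier G"
    using fin x y card_image[OF inj] ord P_carrier
    by (intro card_subset_eq) (auto simp: order_def card_cartesian_product)
  ultimately have "?f \<in> iso P G" by (simp add: iso_def bij_betw_def)
  then have "P \<cong> G" by (auto simp: is_iso_def)
  then show ?thesis using group.iso_sym[OF P] by blast
qed

lemma conj_int_pow: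
  assumes "x \<in> carrier G" "y \<in> carrier G"
  shows "(y \<otimes> x \<otimes> inv y) [^] (i::int) = y \<otimes> x [^] i \<otimes> inv y"
proof -
  have "(\<lambda>a. y \<otimes> a \<otimes> inv y) \<in> hom G G"
    using assms by (intro homI) (simp_all add: group_simps)
  then interpret group_hom G G "\<lambda>a. y \<otimes> a \<otimes> inv y"
    by (simp add: group_hom_def group_hom_axioms_def is_group)
  show ?thesis using hom_int_pow assms by simp
qed

lemma iso_inversion_semidirect_product:
  assumes fin: "finite (carrier G)" and x: "x \<in> carrier G" and y: "y \<in> carrier G"
    and triv: "\<And>(i::int) (j::int). x [^] i = y [^] j \<Longrightarrow> x [^] i = \<one>"
    and ord: "order G = ord x * ord y" and ev: "even (ord y)"
    and inv: "y \<otimes> x = inv x \<otimes> y"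
  shows "G \<cong> semidirect_product (integer_mod_group (ord x)) (integer_mod_group (ord y))
    (inversion_action (integer_mod_group (ord x)))" (is "G \<cong> ?P")
\<comment> \<open>The inverse in \<open>integer_mod_group\<close> is a reduced representative, hence
  the \<open>mod\<close> in \<open>\<phi>\<close>.\<close>
proof (rule iso_if_normal_form[OF fin _ x y triv ord,
    where \<phi> = "\<lambda>h i. if even h then i else (- i) mod int (ord x)"])
  show "group ?P" using ev by (intro group_inversion_semidirect_product) simp_all
  have pos: "ord x > 0" "ord y > 0" using ord_ge_1[OF fin] x y by fastforce+
  then show C: "carrier ?P = {0..<int (ord x)} \<times> {0..<int (ord y)}"
    by (simp add: semidirect_product_def carrier_integer_mod_group)
  show "(i, h) \<otimes>\<^bsub>?P\<^esub> (i', h') =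
      ((i + (if even h then i' else (- i') mod int (ord x))) mod int (ord x), (h + h') mod int (ord y))"
    if "(i, h) \<in> carrier ?P" "(i', h') \<in> carrier ?P" for i h i' h'
    using that by (simp add: semidirect_product_def inversion_action_def)
  show "y [^] h \<otimes> x [^] i = x [^] (if even h then i else (- i) mod int (ord x)) \<otimes> y [^] h"
    if "(i, h) \<in> carrier ?P" for i h
  proof -
    have yx: "y \<otimes> x [^] j = x [^] (- j) \<otimes> y" for j :: int
    proof -
      have "y \<otimes> x \<otimes> inv y = inv x" using inv x y by (simp add: m_assoc)
      then have "inv x [^] j = y \<otimes> x [^] j \<otimes> inv y" using conj_int_pow[OF x y, of j] by simp
      moreover have "inv x [^] j = x [^] (- j)" using x by (simp add: int_pow_inv int_pow_neg)
      ultimately have "x [^] (- j) \<otimes> y = y \<otimes> x [^] j \<otimes> inv y \<otimes> y" by simp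
      then show ?thesis using x y by (simp add: m_assoc)
    qed
    have nat: "y [^] n \<otimes> x [^] j = x [^] (if even n then j else - j) \<otimes> y [^] n" for n :: nat and j :: int
    proof (induction n arbitrary: j)
      case 0
      then show ?case using x by simp
    next
      case (Suc n)
      have "y [^] Suc n \<otimes> x [^] j = y [^] n \<otimes> x [^] (- j) \<otimes> y"
        using yx[of j] x y by (simp add: m_assoc)
      then show ?case using Suc[of "- j"] x y by (simp add: m_assoc)
    qed
    have "0 \<le> h" using that unfolding C by simp
    then obtain n where "h = int n" using zero_le_imp_eq_int by blast
    then have "y [^] h \<otimes> x [^] i = x [^] (if even h then i else - i) \<otimes> y [^] h"
      using nat[of n i] by (simp add: int_pow_int)
    then show ?thesis using int_pow_mod_ord[OF x] by simp
  qed
qed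

lemma iso_DirProd_integer_mod_group:
  assumes fin: "finite (carrier G)" and x: "x \<in> carrier G" and y: "y \<in> carrier G"
    and triv: "\<And>(i::int) (j::int). x [^] i = y [^] j \<Longrightarrow> x [^] i = \<one>"
    and ord: "order G = ord x * ord y" and comm: "y \<otimes> x = x \<otimes> y"
  shows "G \<cong> integer_mod_group (ord x) \<times>\<times> integer_mod_group (ord y)" (is "G \<cong> ?P")
proof (rule iso_if_normal_form[OF fin _ x y triv ord, where \<phi> = "\<lambda>h i. i"])
  show "group ?P" by (simp add: DirProd_group)
  have pos: "ord x > 0" "ord y > 0" using ord_ge_1[OF fin] x y by fastforce+
  then show C: "carrier ?P = {0..<int (ord x)} \<times> {0..<int (ord y)}"
    by (simp add: DirProd_def carrier_integer_mod_group)
  show "(i, h) \<otimes>\<^bsub>?P\<^esub> (i', h') = ((i + i') mod int (ord x), (h + h') mod int (ord y))"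
    if "(i, h) \<in> carrier ?P" "(i', h') \<in> carrier ?P" for i h i' h'
    by (simp add: DirProd_def)
  show "y [^] h \<otimes> x [^] i = x [^] i \<otimes> y [^] h" if "(i, h) \<in> carrier ?P" for i h
  proof -
    \<comment> \<open>Conjugation by \<open>y\<close> fixes \<open>x\<close>, hence
      \<open>x^i\<close>; therefore conjugation by \<open>x^i\<close> fixes \<open>y\<close>, hence
      \<open>y^h\<close>.\<close>
    have "y \<otimes> x \<otimes> inv y = x" using comm x y by (simp add: m_assoc)
    then have "x [^] i = y \<otimes> x [^] i \<otimes> inv y" using conj_int_pow[OF x y, of i] by simp
    then have 1: "x [^] i \<otimes> y = y \<otimes> x [^] i" using x y by (metis inv_solve_right int_pow_closed m_closed)
    then have "x [^] i \<otimes> y \<otimes> inv (x [^] i) = y" using x y by (simp add: m_assoc)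
    then have "y [^] h = x [^] i \<otimes> y [^] h \<otimes> inv (x [^] i)"
      using conj_int_pow[OF y int_pow_closed[OF x], of i h] by simp
    then show ?thesis using x y by (metis inv_solve_right int_pow_closed m_closed)
  qed
qed

end

section \<open>Isomorphism invariance and the counts in the listed groups\<close>

lemma card_cyclic_subgroups_iso:
  assumes G: "group G" and H: "group H" and iso: "G \<cong> H"
  shows "card (cyclic_subgroups G) = card (cyclic_subgroups H)"
proof -
  obtain f where f: "f \<in> hom G H" "bij_betw f (carrier G) (carrier H)"
    using iso by (auto simp: is_iso_def iso_def)
  interpret group_hom G H f using G H f(1) by (simp add: group_hom_def group_hom_axioms_def)
  have gen: "f ` generate G {x} = generate H {f x}" if "x \<in> carrier G" for x
    using generate_img[of "{x}"] that by simp
  have "(\<lambda>S. f ` S) ` cyclic_subgroups G = (\<lambda>x. generate H {f x}) ` carrier G"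
    unfolding G.cyclic_subgroups_eq image_image using gen by (intro image_cong) auto
  also have "\<dots> = (\<lambda>x. generate H {x}) ` f ` carrier G" by (simp add: image_image)
  also have "\<dots> = cyclic_subgroups H" using f(2) by (simp add: H.cyclic_subgroups_eq bij_betw_def)
  finally have "cyclic_subgroups H = (\<lambda>S. f ` S) ` cyclic_subgroups G" by simp
  moreover have "inj_on (\<lambda>S. f ` S) (cyclic_subgroups G)"
    by (rule inj_on_subset[OF inj_on_image_Pow[OF bij_betw_imp_inj_on[OF f(2)]]])
       (auto simp: cyclic_subgroups_def dest: subgroup.subset)
  ultimately show ?thesis by (simp add: card_image)
qed

lemma group_integer_mod_group_DirProd: "group (integer_mod_group m \<times>\<times> integer_mod_group n)"
  by (simp add: DirProd_group)

lemma card_cyclic_subgroups_integer_mod_group_prime_power: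
  assumes p: "prime p"
  shows "card (cyclic_subgroups (integer_mod_group (p ^ a))) = a + 1"
proof -
  let ?P = "integer_mod_group (p ^ a)"
  interpret group ?P by simp
  have p0: "p > 0" using p by (simp add: prime_gt_0_nat)
  have fin: "finite (carrier ?P)" using p0 by (simp add: carrier_integer_mod_group)
  \<comment> \<open>For \<open>a = 0\<close> the carrier is \<open>{0}\<close>; reducing
    \<open>1\<close> keeps the generator in the carrier.\<close>
  define x where "x = (1 mod int (p ^ a))"
  have x: "x \<in> carrier ?P" using p0 by (simp add: x_def carrier_integer_mod_group)
  have "x [^]\<^bsub>?P\<^esub> n = int n mod int (p ^ a)" for n :: nat
    using p0 by (simp add: x_def mod_simps)
  then have "x [^]\<^bsub>?P\<^esub> n = \<one>\<^bsub>?P\<^esub> \<longleftrightarrow> p ^ a dvd n" for n :: nat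
    by (simp add: mod_eq_0_iff_dvd flip: of_nat_power)
  then have ox: "ord x = p ^ a" using ord_unique[OF x] by blast
  have "order ?P = p ^ a" using p0 by (simp add: order_def carrier_integer_mod_group nat_power_eq)
  then have "generate ?P {x} = carrier ?P"
    using ox generate_pow_card[OF x] generate_singleton_in_carrier[OF x] fin
    by (intro card_subset_eq) (auto simp: order_def)
  then have "card (cyclic_subgroups ?P) = card {d. d dvd ord x} + (order ?P - ord x) div totient 1"
    by (intro card_cyclic_subgroups_if_ord_outside fin x) auto
  then show ?thesis using ox \<open>order ?P = p ^ a\<close> card_divisors_prime_power[OF p] by simp
qed

text \<open>Every nontrivial element has order \<open>p\<close>, so the \<open>p * p - p\<close>
  elements outside \<open>\<langle>x\<rangle>\<close> form \<open>p\<close> classes of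
  \<open>p - 1\<close> generators.\<close>

lemma card_cyclic_subgroups_elementary_abelian:
  assumes p: "prime p"
  shows "card (cyclic_subgroups (integer_mod_group p \<times>\<times> integer_mod_group p)) = p + 2"
proof -
  let ?P = "integer_mod_group p \<times>\<times> integer_mod_group p"
  interpret group ?P by (rule group_integer_mod_group_DirProd)
  have p1: "p > 1" using p by (rule prime_gt_1_nat)
  have C: "carrier ?P = {0..<int p} \<times> {0..<int p}"
    using p1 by (simp add: DirProd_def carrier_integer_mod_group)
  then have fin: "finite (carrier ?P)" and n: "order ?P = p * p"
    by (simp_all add: order_def card_cartesian_product)
  have pw: "(i, j) [^]\<^bsub>?P\<^esub> n = ((int n * i) mod int p, (int n * j) mod int p)" if "(i, j) \<in> carrier ?P" for i j and n :: nat
    by (induction n) (simp_all add: DirProd_def mod_simps algebra_simps)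
  have ord: "ord g = p" if g: "g \<in> carrier ?P" "g \<noteq> \<one>\<^bsub>?P\<^esub>" for g
  proof (rule ord_eq_primeI[OF g(1) _ g(2) p])
    show "g [^]\<^bsub>?P\<^esub> p = \<one>\<^bsub>?P\<^esub>" using pw g(1) by (cases g) (simp add: DirProd_def)
  qed
  define x where "x = (1::int, 0::int)"
  have x: "x \<in> carrier ?P" "x \<noteq> \<one>\<^bsub>?P\<^esub>" using p1 C by (auto simp: x_def DirProd_def)
  have "ord g = p" if "g \<in> carrier ?P" "g \<notin> generate ?P {x}" for g
    using ord that generate.one by metis
  then have "card (cyclic_subgroups ?P) = card {d. d dvd ord x} + (order ?P - ord x) div totient p"
    using p1 by (intro card_cyclic_subgroups_if_ord_outside fin x) auto
  also have "\<dots> = 2 + (p * p - p) div (p - 1)"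
    using ord[OF x] n card_divisors_prime_power[OF p, of 1] totient_prime[OF p] by simp
  also have "p * p - p = p * (p - 1)" by (simp add: algebra_simps)
  finally show ?thesis using p1 by simp
qed

text \<open>Outside the rotations lie the \<open>n\<close> reflections, each generating its own
  subgroup of order 2. The value 7 arises as \<open>3 + 4\<close> for \<open>n = 4\<close> and as
  \<open>2 + 5\<close> for \<open>n = 5\<close>.\<close>

lemma card_cyclic_subgroups_dihedral_group:
  assumes n: "n > 0"
  shows "card (cyclic_subgroups (dihedral_group n)) = card {d. d dvd n} + n"
proof -
  let ?P = "dihedral_group n"
  interpret group ?P by (rule group_dihedral_group)
  note defs = dihedral_group_def semidirect_product_def inversion_action_def
  have C: "carrier ?P = {0..<int n} \<times> {0..<2}"
    using n by (simp add: defs carrier_integer_mod_group)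
  then have fin: "finite (carrier ?P)" by simp
  define x where "x = (1 mod int n, 0::int)"
  have x: "x \<in> carrier ?P" using n by (simp add: C x_def)
  have pw: "x [^]\<^bsub>?P\<^esub> k = (int k mod int n, 0)" for k :: nat
  proof (induction k)
    case 0
    then show ?case by (simp add: defs)
  next
    case (Suc k)
    then show ?case by (simp add: defs x_def mod_simps add.commute)
  qed
  have "x [^]\<^bsub>?P\<^esub> k = \<one>\<^bsub>?P\<^esub> \<longleftrightarrow> n dvd k" for k :: nat
    unfolding pw by (simp add: defs mod_eq_0_iff_dvd)
  then have ox: "ord x = n" using ord_unique[OF x] by blast
  have "ord g = 2" if g: "g \<in> carrier ?P" "g \<notin> generate ?P {x}" for g
  proof -
    obtain i h where ih: "g = (i, h)" by fastforce
    have "h = 1"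
    proof (rule ccontr)
      assume "h \<noteq> 1"
      then have "h = 0" using g(1) ih C by auto
      then have "g = x [^]\<^bsub>?P\<^esub> nat i" using g(1) ih C pw by simp
      then show False using g(2) mem_generate_singleton_iff[OF fin x] by blast
    qed
    then have "g [^]\<^bsub>?P\<^esub> (2::nat) = \<one>\<^bsub>?P\<^esub>"
      using g(1) ih C by (simp add: numeral_2_eq_2 nat_pow_def) (simp add: defs carrier_integer_mod_group mod_simps)
    moreover have "g \<noteq> \<one>\<^bsub>?P\<^esub>" using \<open>h = 1\<close> ih by (simp add: defs)
    ultimately show ?thesis using ord_eq_primeI[OF g(1)] by simp
  qed
  then have "card (cyclic_subgroups ?P) = card {d. d dvd ord x} + (order ?P - ord x) div totient 2"
    by (intro card_cyclic_subgroups_if_ord_outside fin x) auto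
  then show ?thesis using ox order_dihedral_group[OF n] by simp
qed

lemma card_cyclic_subgroups_Z3_semidirect_Z4: "card (cyclic_subgroups Z3_semidirect_Z4) = 7"
proof -
  let ?P = Z3_semidirect_Z4
  interpret group ?P by (rule group_Z3_semidirect_Z4)
  note defs = Z3_semidirect_Z4_def semidirect_product_def inversion_action_def carrier_integer_mod_group
  have C: "carrier ?P = {0..<3} \<times> {0..<4}" and one: "\<one>\<^bsub>?P\<^esub> = (0, 0)" by (simp_all add: defs)
  then have fin: "finite (carrier ?P)" by simp
  \<comment> \<open>The element \<open>(1, 2)\<close> combines a generator of the factor of order 3
    with the central involution \<open>(0, 2)\<close>, so it has order 6. Its powers are the pairs
    with even second component.\<close>
  define x where "x = (1::int, 2::int)"
  have x: "x \<in> carrier ?P" by (simp add: C x_def)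
  have pw: "x [^]\<^bsub>?P\<^esub> k = (int k mod 3, (2 * int k) mod 4)" for k :: nat
  proof (induction k)
    case 0
    then show ?case by (simp add: defs)
  next
    case (Suc k)
    have "even ((2 * int k) mod 4)" by presburger
    then show ?case using Suc by (simp add: defs x_def mod_simps algebra_simps)
  qed
  have "x [^]\<^bsub>?P\<^esub> k = \<one>\<^bsub>?P\<^esub> \<longleftrightarrow> 6 dvd k" for k :: nat
    unfolding pw by (simp add: defs) presburger
  then have ox: "ord x = 6" using ord_unique[OF x] by blast
  have "ord g = 4" if g: "g \<in> carrier ?P" "g \<notin> generate ?P {x}" for g
  proof -
    obtain i h where ih: "g = (i, h)" by fastforce
    have i: "i \<in> {0, 1, 2}" and h: "h \<in> {0, 1, 2, 3}" using g(1) ih C by auto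
    have "g \<noteq> x [^]\<^bsub>?P\<^esub> k" for k :: nat
      using g(2) mem_generate_singleton_iff[OF fin x] by blast
    from this[of 0] this[of 1] this[of 2] this[of 3] this[of 4] this[of 5]
    have "h = 1 \<or> h = 3" unfolding pw using ih i h by auto
    \<comment> \<open>As \<open>h\<close> is odd, it acts by inversion, so the first components
      cancel in the square, and \<open>2 * h = 2\<close> modulo 4.\<close>
    then have g2: "g [^]\<^bsub>?P\<^esub> (2::nat) = (0, 2)" and g4: "g [^]\<^bsub>?P\<^esub> (4::nat) = \<one>\<^bsub>?P\<^esub>"
      using ih i by (auto simp: numeral_eq_Suc nat_pow_def) (auto simp: defs)
    have "ord g dvd 4" "\<not> ord g dvd 2"
      using g4 g2 pow_eq_id[OF g(1), of 4] pow_eq_id[OF g(1), of 2] one by simp_all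
    moreover have "d = 4" if "d dvd 4" "\<not> d dvd 2" for d :: nat
    proof -
      have "d \<le> 4" using that(1) by (rule dvd_imp_le) simp
      then have "d = 0 \<or> d = 1 \<or> d = 2 \<or> d = 3 \<or> d = 4" by linarith
      then show ?thesis using that by (elim disjE) simp_all
    qed
    ultimately show "ord g = 4" by blast
  qed
  then have "card (cyclic_subgroups ?P) = card {d. d dvd ord x} + (order ?P - ord x) div totient 4"
    by (intro card_cyclic_subgroups_if_ord_outside fin x) auto
  moreover have "card {d::nat. d dvd 6} = 4"
    using card_divisors_prime_power_mult[of 2 3 1] card_divisors_prime_power[of 3 1] by simp
  ultimately show ?thesis using ox order_Z3_semidirect_Z4 by simp
qed

section \<open>Noncyclic groups with seven cyclic subgroups\<close>

text \<open>A finite group is cyclic exactly if some element has order \<open>order G\<close>. For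
  \<open>x\<close> of maximal order, being noncyclic is therefore the condition
  \<open>k \<ge> 2\<close>.\<close>

locale noncyclic_with_7_cyclic_subgroups = group +
  fixes x :: 'a and k :: nat
  assumes fin: "finite (carrier G)" and x: "x \<in> carrier G"
    and card_7: "card (cyclic_subgroups G) = 7"
    and max: "\<And>g. g \<in> carrier G \<Longrightarrow> ord g \<le> ord x"
    and order: "order G = k * ord x" and k: "k \<ge> 2"
begin

definition outside :: "'a set" where
  "outside = carrier G - generate G {x}"

definition outer :: "'a set set" where
  "outer = {H \<in> cyclic_subgroups G. \<not> H \<subseteq> generate G {x}}"

lemma M: "subgroup (generate G {x}) G"
  using x by (simp add: generate_is_subgroup)

lemma outsideD: "g \<in> outside \<Longrightarrow> g \<in> carrier G \<and> g \<notin> generate G {x}"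
  by (simp add: outside_def)

lemma m_pos: "ord x > 0"
  using ord_ge_1[OF fin x] by simp

text \<open>Maximality of \<open>ord x\<close> adds \<open>j * d \<le> ord x\<close>, which makes
  \<open>d\<close> a proper divisor; the divisibility of \<open>k * ord x\<close> is Lagrange's
  theorem.\<close>

lemma outsideE:
  assumes "g \<in> outside"
  obtains j d where "2 \<le> j" "j \<le> k" "d dvd ord x" "ord g = j * d" "d > 0"
    "j * d \<le> ord x" "j * d dvd k * ord x"
proof -
  obtain j d where jd: "2 \<le> j" "j \<le> k" "d dvd ord x" "ord g = j * d"
    using ord_outside_cyclic[OF fin x order] outsideD[OF assms] by metis
  moreover have "d > 0" using jd(3) m_pos by (auto intro!: gr0I)
  ultimately show ?thesis
    using that max[of g] outsideD[OF assms] ord_dvd_group_order[of g] order by metis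
qed

lemma ex_outside: "\<exists>y. y \<in> outside"
proof (rule ccontr)
  assume "\<nexists>y. y \<in> outside"
  then have "carrier G \<subseteq> generate G {x}" by (auto simp: outside_def)
  then have "generate G {x} = carrier G" using generate_singleton_in_carrier[OF x] by blast
  then have "order G = ord x" using generate_pow_card[OF x] by (simp add: order_def)
  then show False using order k m_pos by simp
qed

lemma m_ge_2: "ord x \<ge> 2"
proof -
  obtain y where "y \<in> outside" using ex_outside by blast
  then obtain j d :: nat where "2 \<le> j" "d > 0" "j * d \<le> ord x" using outsideE by metis
  then have "2 * 1 \<le> j * d" by (intro mult_le_mono) auto
  then show ?thesis using \<open>j * d \<le> ord x\<close> by simp
qed

lemma finite_outer: "finite outer"
  using finite_cyclic_subgroups[OF fin] by (simp add: outer_def)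

lemma card_outer: "card outer + card {d. d dvd ord x} = 7"
  using card_cyclic_subgroups_outside[OF fin x] card_7 by (simp add: outer_def)

lemma sum_outer: "(\<Sum>H\<in>outer. totient (card H)) = (k - 1) * ord x"
  using sum_totient_cyclic_outside[OF fin M] generate_pow_card[OF x] order
  by (simp add: outer_def diff_mult_distrib)

lemma outerE:
  assumes "H \<in> outer"
  obtains g where "g \<in> outside" "H = generate G {g}" "card H = ord g"
proof -
  obtain g where g: "g \<in> carrier G" "H = generate G {g}"
    using assms by (auto simp: outer_def cyclic_subgroups_eq)
  then have "g \<in> outside"
    using assms generate_singleton_in_subgroup_iff[OF M] by (simp add: outer_def outside_def)
  then show ?thesis using that g generate_pow_card by metis
qed

lemma generate_in_outer:
  assumes "g \<in> outside"
  shows "generate G {g} \<in> outer" "card (generate G {g}) = ord g"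
  using assms generate_singleton_in_subgroup_iff[OF M, of g] generate_pow_card[of g]
  by (auto simp: outer_def outside_def cyclic_subgroups_eq)

section \<open>Bounds from the generator count\<close>

lemma sum_outer_le:
  assumes "\<And>g. g \<in> outside \<Longrightarrow> totient (ord g) \<le> B"
  shows "(k - 1) * ord x \<le> card outer * B"
proof -
  have "(\<Sum>H\<in>outer. totient (card H)) \<le> of_nat (card outer) * B"
    by (rule sum_bounded_above) (metis outerE assms)
  then show ?thesis using sum_outer by simp
qed

text \<open>A sum that attains a termwise upper bound attains it in every term; this converts a
  tight count into exact totients.\<close>

lemma sum_outer_eqD:
  assumes le: "\<And>g. g \<in> outside \<Longrightarrow> totient (ord g) \<le> B"
    and eq: "(k - 1) * ord x = card outer * B" and g: "g \<in> outside"
  shows "totient (ord g) = B"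
proof (rule ccontr)
  assume "totient (ord g) \<noteq> B"
  then have "totient (card (generate G {g})) < B"
    using le[OF g] generate_in_outer[OF g] by simp
  then have "(\<Sum>H\<in>outer. totient (card H)) < (\<Sum>H\<in>outer. B)"
    using generate_in_outer(1)[OF g] le
    by (intro sum_strict_mono_ex1 finite_outer) (auto elim: outerE)
  then show False using eq sum_outer by simp
qed

lemma sum_outer_eqD':
  assumes ge: "\<And>g. g \<in> outside \<Longrightarrow> B \<le> totient (ord g)"
    and eq: "(k - 1) * ord x = card outer * B" and g: "g \<in> outside"
  shows "totient (ord g) = B"
proof (rule ccontr)
  assume "totient (ord g) \<noteq> B"
  then have "B < totient (card (generate G {g}))"
    using ge[OF g] generate_in_outer[OF g] by simp
  then have "(\<Sum>H\<in>outer. B) < (\<Sum>H\<in>outer. totient (card H))"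
    using generate_in_outer(1)[OF g] ge
    by (intro sum_strict_mono_ex1 finite_outer) (auto elim: outerE)
  then show False using eq sum_outer by simp
qed

text \<open>Two summands known to be small sharpen the general bound; two distinct outer subgroups
  of order 2 can be excluded in this way.\<close>

lemma sum_outer_le_two:
  assumes le: "\<And>g. g \<in> outside \<Longrightarrow> totient (ord g) \<le> B"
    and g: "g \<in> outside" "totient (ord g) \<le> b" and h: "h \<in> outside" "totient (ord h) \<le> b"
    and ne: "generate G {g} \<noteq> generate G {h}"
  shows "(k - 1) * ord x \<le> 2 * b + (card outer - 2) * B"
proof -
  let ?T = "{generate G {g}, generate G {h}}"
  have T: "?T \<subseteq> outer" using generate_in_outer g h by auto
  have "(\<Sum>H\<in>outer. totient (card H)) =
      (\<Sum>H\<in>outer - ?T. totient (card H)) + (\<Sum>H\<in>?T. totient (card H))"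
    using sum.subset_diff[OF T finite_outer] .
  also have "(\<Sum>H\<in>?T. totient (card H)) \<le> 2 * b"
    using ne g h generate_in_outer by simp
  also have "(\<Sum>H\<in>outer - ?T. totient (card H)) \<le> of_nat (card (outer - ?T)) * B"
    by (rule sum_bounded_above) (metis outerE le DiffD1)
  also have "card (outer - ?T) = card outer - 2"
    using ne T by (subst card_Diff_subset) auto
  finally show ?thesis using sum_outer by simp
qed

lemma sum_outer_le_one:
  assumes le: "\<And>g. g \<in> outside \<Longrightarrow> totient (ord g) \<le> B"
    and g: "g \<in> outside" "totient (ord g) \<le> b"
  shows "(k - 1) * ord x \<le> b + (card outer - 1) * B"
proof -
  let ?T = "{generate G {g}}"
  have T: "?T \<subseteq> outer" using generate_in_outer g by auto
  have "(\<Sum>H\<in>outer. totient (card H)) =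
      (\<Sum>H\<in>outer - ?T. totient (card H)) + (\<Sum>H\<in>?T. totient (card H))"
    using sum.subset_diff[OF T finite_outer] .
  also have "(\<Sum>H\<in>?T. totient (card H)) \<le> b"
    using g generate_in_outer by simp
  also have "(\<Sum>H\<in>outer - ?T. totient (card H)) \<le> of_nat (card (outer - ?T)) * B"
    by (rule sum_bounded_above) (metis outerE le DiffD1)
  also have "card (outer - ?T) = card outer - 1"
    using T by (subst card_Diff_subset) auto
  finally show ?thesis using sum_outer by simp
qed

lemma totient_outside_le:
  assumes "g \<in> outside" "\<And>d. d dvd ord x \<Longrightarrow> 2 * d \<le> ord x \<Longrightarrow> d \<le> D"
  shows "totient (ord g) \<le> (k - 1) * D"
proof -
  obtain j d where jd: "2 \<le> j" "j \<le> k" "d dvd ord x" "ord g = j * d" "j * d \<le> ord x"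
    using outsideE[OF assms(1)] by metis
  have "2 * d \<le> j * d" using jd(1) by simp
  then have "2 * d \<le> ord x" using jd(5) by (rule le_trans)
  then have "d \<le> D" using jd(3) by (intro assms(2))
  have "totient (ord g) \<le> (j - 1) * d" using totient_mult_le[OF jd(1)] jd(4) by simp
  also have "\<dots> \<le> (k - 1) * D" using jd(2) \<open>d \<le> D\<close> by (intro mult_le_mono) auto
  finally show ?thesis .
qed

text \<open>The factor \<open>k - 1\<close> occurs both in the sum and in the bound for each
  summand. It cancels, so the resulting bound does not depend on \<open>k\<close>.\<close>

lemma m_le:
  assumes "\<And>d. d dvd ord x \<Longrightarrow> 2 * d \<le> ord x \<Longrightarrow> d \<le> D"
  shows "ord x \<le> card outer * D"
proof -
  have "(k - 1) * ord x \<le> card outer * ((k - 1) * D)"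
    using totient_outside_le assms by (intro sum_outer_le) blast
  then have "(k - 1) * ord x \<le> (k - 1) * (card outer * D)" by (simp add: ac_simps)
  then show ?thesis using k by simp
qed

lemma totient_ord_less:
  assumes "g \<in> outside"
  shows "totient (ord g) \<le> ord x - 1"
proof -
  obtain j d where jd: "2 \<le> j" "ord g = j * d" "d > 0" using outsideE[OF assms] by metis
  then have "2 * 1 \<le> j * d" by (intro mult_le_mono) auto
  then have "totient (ord g) < ord g" using jd by (intro totient_less) simp
  then show ?thesis using max[of g] outsideD[OF assms] by simp
qed

text \<open>Each summand \<open>totient (ord g)\<close> is strictly below \<open>ord x\<close>, so
  the sum \<open>(k - 1) * ord x\<close> is strictly below
  \<open>card outer * ord x\<close>.\<close>

lemma k_minus_1_less: "k - 1 < card outer"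
proof -
  have "(k - 1) * ord x \<le> card outer * (ord x - 1)"
    using totient_ord_less by (rule sum_outer_le)
  also have "\<dots> < card outer * ord x"
  proof -
    obtain y where "y \<in> outside" using ex_outside by blast
    then have "card outer > 0" using generate_in_outer finite_outer by (metis card_gt_0_iff empty_iff)
    then show ?thesis using m_pos by simp
  qed
  finally show ?thesis by simp
qed

text \<open>Proper divisors are at most \<open>ord x div 2\<close>, so
  \<open>ord x \<le> card outer * (ord x div 2)\<close>. At least two cyclic subgroups thus lie
  outside, and at most \<open>7 - 2\<close> remain for the divisors.\<close>

lemma card_divisors_m: "card {d. d dvd ord x} \<le> 5"
proof -
  have "ord x \<le> card outer * (ord x div 2)" by (rule m_le) simp
  also have "2 * \<dots> \<le> card outer * ord x" by simp
  finally have "2 * ord x \<le> card outer * ord x" by simp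
  then have "2 \<le> card outer" using m_pos by simp
  then show ?thesis using card_outer by simp
qed

section \<open>Recognition of the listed noncyclic groups and exclusion of order 12\<close>

text \<open>Both \<open>y\<close> and \<open>x y\<close> lie outside and are involutions, so their
  squares agree and \<open>y\<close> inverts \<open>x\<close>.\<close>

lemma iso_dihedral_group:
  assumes "k = 2" and ord: "\<And>g. g \<in> outside \<Longrightarrow> ord g = 2"
  shows "G \<cong> dihedral_group (ord x)"
proof -
  obtain y where y: "y \<in> outside" using ex_outside by blast
  then have yG: "y \<in> carrier G" and yM: "y \<notin> generate G {x}" using outsideD by auto
  have "x \<otimes> y \<in> outside"
    using mult_mem_subgroup_iff(1)[OF M in_generate_singleton yG] yM x yG by (simp add: outside_def)
  then have "ord (x \<otimes> y) = 2" "ord y = 2" using ord y by auto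
  then have sq: "(x \<otimes> y) [^] (2::nat) = y [^] (2::nat)" and y2: "y [^] (2::nat) = \<one>"
    using pow_ord_eq_1[of "x \<otimes> y"] pow_ord_eq_1[of y] x yG by simp_all
  have "x [^] i = \<one>" if eq: "x [^] i = y [^] j" for i j :: int
  proof (cases "even j")
    case True
    then show ?thesis using eq int_pow_eq_id[OF yG, of j] \<open>ord y = 2\<close> by simp
  next
    case False
    then have "y [^] j = y [^] (1::int)"
      using int_pow_eq[OF yG, of j 1] \<open>ord y = 2\<close> by simp
    then have "y = x [^] i" using eq yG by simp
    then have "y \<in> generate G {x}" using generate_pow[OF x] by auto
    then show ?thesis using yM by simp
  qed
  then have "G \<cong> semidirect_product (integer_mod_group (ord x)) (integer_mod_group (ord y))
      (inversion_action (integer_mod_group (ord x)))"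
    using order \<open>k = 2\<close> \<open>ord y = 2\<close> inverts_if_square_eq[OF x yG sq]
    by (intro iso_inversion_semidirect_product fin x yG) auto
  then show ?thesis using \<open>ord y = 2\<close> by (simp add: dihedral_group_def)
qed

lemma no_order_12:
  assumes "order G = 12" "ord x < 6"
    and z: "z \<in> carrier G" "ord z = 2"
    and uniq: "\<And>y. y \<in> carrier G \<Longrightarrow> ord y = 2 \<Longrightarrow> y = z"
  shows False
proof -
  have "prime (3::nat)" by simp
  then obtain w where w: "w \<in> carrier G" "ord w = 3"
    using ex_ord_eq_prime[OF fin, of 3] assms(1) by auto
  then have "ord (z \<otimes> w) = 6" using ord_6_if_unique_involution[OF z uniq] by blast
  then show False using max[of "z \<otimes> w"] z w assms(2) by simp
qed

lemma involution_unique: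
  assumes "\<And>g. g \<in> outside \<Longrightarrow> ord g \<noteq> 2"
    and "y \<in> carrier G" "ord y = 2" "z \<in> carrier G" "ord z = 2"
  shows "y = z"
  using assms involution_in_cyclic_unique[OF fin x, of y z] by (auto simp: outside_def)

text \<open>Both \<open>\<langle>x\<rangle>\<close> and \<open>\<langle>y\<rangle>\<close> have
  index \<open>p\<close>, so each is preserved by conjugation. The commutator of \<open>x\<close>
  and \<open>y\<close> is \<open>inv x\<close> times a conjugate of \<open>x\<close>, and also the
  inverse of a conjugate of \<open>y\<close> times \<open>y\<close>; hence it lies in both and is
  trivial.\<close>

lemma iso_elementary_abelian:
  assumes p: "prime p" and "k = p" "ord x = p"
    and ord: "\<And>g. g \<in> outside \<Longrightarrow> ord g = p"
  shows "G \<cong> integer_mod_group p \<times>\<times> integer_mod_group p"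
proof -
  obtain y where y: "y \<in> outside" using ex_outside by blast
  then have yG: "y \<in> carrier G" and yM: "y \<notin> generate G {x}" using outsideD by auto
  have oy: "ord y = p" using ord y by blast
  have My: "subgroup (generate G {y}) G" using yG by (simp add: generate_is_subgroup)
  have triv: "c = \<one>" if c: "c \<in> generate G {x}" "c \<in> generate G {y}" for c
  proof (rule ccontr)
    assume "c \<noteq> \<one>"
    have cG: "c \<in> carrier G" using c(1) M subgroup.mem_carrier by metis
    obtain i :: nat where "c = x [^] i" using c(1) mem_generate_singleton_iff[OF fin x] by blast
    then have "c [^] p = \<one>" using x \<open>ord x = p\<close> by (simp add: nat_pow_pow pow_eq_id)
    then have "ord c = p" using ord_eq_primeI[OF cG _ \<open>c \<noteq> \<one>\<close> p] by simp
    then have "generate G {c} = generate G {x}" "generate G {c} = generate G {y}"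
      using generate_singleton_eqI[OF fin x c(1)] generate_singleton_eqI[OF fin yG c(2)] oy
        \<open>ord x = p\<close> by simp_all
    then show False using yM in_generate_singleton by metis
  qed
  have cop: "coprime t p" if "0 < t" "t < p" for t
  proof -
    have "\<not> p dvd t" using that nat_dvd_not_less by blast
    then show ?thesis using p prime_imp_coprime[of p t] by (simp add: coprime_commute)
  qed
  have n: "order G = p * p" using order assms by simp
  let ?c = "inv x \<otimes> (inv y \<otimes> x \<otimes> y)"
  have "inv y \<otimes> x \<otimes> y \<in> generate G {x}"
    using conj_mem_cyclic[OF fin x, of p y] cop n assms(3) yG by simp
  then have "?c \<in> generate G {x}"
    using M in_generate_singleton by (simp add: subgroup.m_closed subgroup.m_inv_closed)
  moreover have "inv x \<otimes> y \<otimes> x \<in> generate G {y}"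
    using conj_mem_cyclic[OF fin yG, of p x] cop n oy x by simp
  then have "inv (inv x \<otimes> y \<otimes> x) \<otimes> y \<in> generate G {y}"
    using My in_generate_singleton by (simp add: subgroup.m_closed subgroup.m_inv_closed)
  then have "?c \<in> generate G {y}" using x yG by (simp add: group_simps)
  ultimately have c1: "?c = \<one>" by (rule triv)
  have "y \<otimes> x \<otimes> ?c = x \<otimes> y" using x yG by (simp add: group_simps)
  then have comm: "y \<otimes> x = x \<otimes> y" using c1 x yG by simp
  have "G \<cong> integer_mod_group (ord x) \<times>\<times> integer_mod_group (ord y)"
  proof (rule iso_DirProd_integer_mod_group[OF fin x yG _ _ comm])
    show "order G = ord x * ord y" using n oy assms(3) by simp
    show "x [^] i = \<one>" if "x [^] i = y [^] j" for i j :: int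
    proof (rule triv)
      show "x [^] i \<in> generate G {x}" using generate_pow[OF x] by auto
      show "x [^] i \<in> generate G {y}" unfolding that using generate_pow[OF yG] by auto
    qed
  qed
  then show ?thesis using oy assms(3) by simp
qed

text \<open>No involution lies outside \<open>\<langle>x\<rangle>\<close>, so the involutions
  \<open>y^2\<close> and \<open>(x y)^2\<close> coincide. Hence \<open>y\<close> inverts
  \<open>x\<close>, and with it \<open>a = x^2\<close>, the generator of the factor of order
  3.\<close>

lemma iso_Z3_semidirect_Z4:
  assumes "k = 2" "ord x = 6" and ord: "\<And>g. g \<in> outside \<Longrightarrow> ord g = 4"
  shows "G \<cong> Z3_semidirect_Z4"
proof -
  obtain y where y: "y \<in> outside" using ex_outside by blast
  then have yG: "y \<in> carrier G" and yM: "y \<notin> generate G {x}" using outsideD by auto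
  have xy: "x \<otimes> y \<in> outside"
    using mult_mem_subgroup_iff(1)[OF M in_generate_singleton yG] yM x yG by (simp add: outside_def)
  have "ord (y [^] (2::nat)) = 2" "ord ((x \<otimes> y) [^] (2::nat)) = 2"
    using ord_pow[of _ 2] ord y xy x yG by simp_all
  then have sq: "(x \<otimes> y) [^] (2::nat) = y [^] (2::nat)"
    using involution_unique ord x yG by (metis m_closed nat_pow_closed numeral_eq_iff semiring_norm(85) semiring_norm(87) semiring_norm(88))
  define a where "a = x [^] (2::nat)"
  have a: "a \<in> carrier G" "ord a = 3" using x assms(2) ord_pow[OF x, of 2] by (simp_all add: a_def)
  have yx: "y \<otimes> x = inv x \<otimes> y" using inverts_if_square_eq[OF x yG sq] .
  have "y \<otimes> a = (y \<otimes> x) \<otimes> x" using x yG by (simp add: a_def numeral_2_eq_2 m_assoc)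
  also have "\<dots> = inv x \<otimes> (y \<otimes> x)" using x yG yx by (simp add: m_assoc)
  also have "\<dots> = inv a \<otimes> y" using x yG yx by (simp add: a_def numeral_2_eq_2 group_simps)
  finally have ya: "y \<otimes> a = inv a \<otimes> y" .
  have oy: "ord y = 4" using ord y by simp
  have triv: "a [^] i = \<one>" if eq: "a [^] i = y [^] j" for i j :: int
  proof -
    \<comment> \<open>The exponent 4 kills \<open>y\<close>, and 4 is invertible modulo
      \<open>ord a = 3\<close>.\<close>
    have "a [^] (4 * i) = y [^] (4 * j)"
      using eq int_pow_pow[OF a(1), of i 4] int_pow_pow[OF yG, of j 4] by (simp add: mult.commute)
    also have "\<dots> = \<one>" using int_pow_eq_id[OF yG, of "4 * j"] oy by simp
    finally have "3 dvd 4 * i" using int_pow_eq_id[OF a(1), of "4 * i"] a(2) by simp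
    then have "3 dvd i" by presburger
    then show ?thesis using int_pow_eq_id[OF a(1), of i] a(2) by simp
  qed
  have "G \<cong> semidirect_product (integer_mod_group (ord a)) (integer_mod_group (ord y))
      (inversion_action (integer_mod_group (ord a)))"
    by (rule iso_inversion_semidirect_product[OF fin a(1) yG triv _ _ ya])
       (use order assms a oy in simp_all)
  then show ?thesis using a oy by (simp add: Z3_semidirect_Z4_def)
qed

section \<open>Cases by the factorisation of the maximal order\<close>

text \<open>The only proper divisor of \<open>ord x\<close> is 1, so outside orders are at most
  \<open>k\<close>, and the generator count gives \<open>ord x \<le> 5\<close>. For
  \<open>ord x = 5\<close> the count is tight, so every outside order is exactly
  \<open>k\<close>.\<close>

lemma case_prime:
  assumes p: "prime (ord x)" and \<tau>: "card {d. d dvd ord x} = 2"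
  shows "G \<cong> dihedral_group 5 \<or> G \<cong> integer_mod_group 5 \<times>\<times> integer_mod_group 5"
proof -
  have c: "card outer = 5" using card_outer \<tau> by simp
  have e: "2 \<le> ord g \<and> ord g \<le> k \<and> ord g \<le> ord x \<and> ord g dvd k * ord x" if g: "g \<in> outside" for g
  proof -
    obtain j d where jd: "2 \<le> j" "j \<le> k" "d dvd ord x" "ord g = j * d" "d > 0" "j * d \<le> ord x"
      "j * d dvd k * ord x" by (rule outsideE[OF g])
    have "d \<noteq> ord x"
    proof
      assume "d = ord x"
      then show False using jd(1,6) m_pos by simp
    qed
    then have "d = 1" using jd(3) p unfolding prime_nat_iff by blast
    then show ?thesis using jd by simp
  qed
  have tot: "totient (ord g) \<le> ord g - 1" if "g \<in> outside" for g
    using e[OF that] totient_less[of "ord g"] by simp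
  have k5: "k \<le> 5" using k_minus_1_less c by simp
  have "(k - 1) * ord x \<le> card outer * (k - 1)"
    by (rule sum_outer_le) (use tot e in \<open>meson diff_le_mono le_trans\<close>)
  then have "(k - 1) * ord x \<le> (k - 1) * 5" using c by simp
  then have m5: "ord x \<le> 5" using k by simp
  have "ord x = 2 \<or> ord x = 3 \<or> ord x = 4 \<or> ord x = 5" using m5 m_ge_2 by linarith
  moreover have "ord x \<noteq> 4" using p by (intro notI) simp
  ultimately consider "ord x = 2" | "ord x = 3" | "ord x = 5" by blast
  then show ?thesis
  proof cases
    case 1
    then have "ord g = 2" if "g \<in> outside" for g using e[OF that] by simp
    then have "(\<Sum>H\<in>outer. totient (card H)) = (\<Sum>H\<in>outer. 1)"
      by (intro sum.cong refl) (metis outerE totient_2)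
    \<comment> \<open>Five summands equal to 1 have an odd sum, but the sum must be
      \<open>(k - 1) * 2\<close>.\<close>
    then show ?thesis using sum_outer c 1 by simp presburger
  next
    case 2
    have e3: "ord g = 2 \<or> ord g = 3" if "g \<in> outside" for g using e[OF that] 2 by linarith
    have le2: "totient (ord g) \<le> 2" if "g \<in> outside" for g using e3[OF that] by auto
    have "(k - 1) * 3 \<le> 5 * 2" using sum_outer_le[of 2] le2 c 2 by simp
    then have "k \<le> 4" by linarith
    then consider "k = 2" | "k = 3" | "k = 4" using k by linarith
    then show ?thesis
    proof cases
      case 1
      have "1 \<le> totient (ord g)" if "g \<in> outside" for g using e3[OF that] by auto
      then have "(\<Sum>H\<in>outer. 1) \<le> (\<Sum>H\<in>outer. totient (card H))"
        by (intro sum_mono) (metis outerE)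
      then show ?thesis using sum_outer c 1 \<open>ord x = 3\<close> by simp
    next
      case k3: 2
      \<comment> \<open>The group order is 9, so no element has order 2, and the sum is at least 10
        instead of 6.\<close>
      have "2 \<le> totient (ord g)" if "g \<in> outside" for g
        using e[OF that] e3[OF that] k3 \<open>ord x = 3\<close> by auto
      then have "(\<Sum>H\<in>outer. 2) \<le> (\<Sum>H\<in>outer. totient (card H))"
        by (intro sum_mono) (metis outerE)
      then show ?thesis using sum_outer c k3 \<open>ord x = 3\<close> by simp
    next
      case k4: 3
      \<comment> \<open>Five summands from \<open>{1, 2}\<close> with sum 9: exactly one equals 1,
        so there is just one involution outside.\<close>
      have "\<exists>z\<in>outside. ord z = 2"
      proof (rule ccontr)
        assume "\<not> (\<exists>z\<in>outside. ord z = 2)"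
        then have "2 \<le> totient (ord g)" if "g \<in> outside" for g
          using e3[OF that] that by auto
        then have "(\<Sum>H\<in>outer. 2) \<le> (\<Sum>H\<in>outer. totient (card H))"
          by (intro sum_mono) (metis outerE)
        then show False using sum_outer c k4 \<open>ord x = 3\<close> by simp
      qed
      then obtain z where z: "z \<in> outside" "ord z = 2" by blast
      have "y = z" if y: "y \<in> carrier G" "ord y = 2" for y
      proof (cases "y \<in> generate G {x}")
        case True
        then obtain i :: nat where "y = x [^] i" using mem_generate_singleton_iff[OF fin x] by blast
        then have "y [^] (3::nat) = \<one>" using x \<open>ord x = 3\<close> by (simp add: nat_pow_pow pow_eq_id)
        then have "ord y dvd 3" using pow_eq_id[OF y(1)] by simp
        then show ?thesis using y(2) by simp
      next
        case False
        then have yo: "y \<in> outside" using y by (simp add: outside_def)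
        have "generate G {y} = generate G {z}"
        proof (rule ccontr)
          assume "generate G {y} \<noteq> generate G {z}"
          then have "(k - 1) * ord x \<le> 2 * 1 + (card outer - 2) * 2"
            using y z yo le2 by (intro sum_outer_le_two) simp_all
          then show False using k4 \<open>ord x = 3\<close> c by simp
        qed
        then have "y \<in> generate G {z}" using in_generate_singleton by metis
        then show ?thesis
          using involution_in_cyclic_unique[OF fin, of z y z] z y in_generate_singleton outsideD by blast
      qed
      then show ?thesis using no_order_12[of z] z outsideD order k4 \<open>ord x = 3\<close> by simp
    qed
  next
    case 3
    have le: "totient (ord g) \<le> k - 1" if "g \<in> outside" for g
      using tot[OF that] e[OF that] by linarith
    have eq: "(k - 1) * ord x = card outer * (k - 1)" using c 3 by simp
    have tk: "totient (ord g) = k - 1" if "g \<in> outside" for g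
      using sum_outer_eqD[OF le eq that] .
    then have ok: "ord g = k" if "g \<in> outside" for g
      using tk[OF that] tot[OF that] e[OF that] by linarith
    obtain y where y: "y \<in> outside" using ex_outside by blast
    \<comment> \<open>Here \<open>totient k = k - 1\<close>, whereas
      \<open>totient 4 = 2\<close>.\<close>
    have "k \<noteq> 4" using tk[OF y] ok[OF y] by auto
    then consider "k = 2" | "k = 3" | "k = 5" using k k5 by linarith
    then show ?thesis
    proof cases
      case 1
      then show ?thesis using iso_dihedral_group ok 3 by simp
    next
      case k3: 2
      \<comment> \<open>All outside orders are 3, so every element of order 5 lies in
        \<open>\<langle>x\<rangle>\<close>; the product of order 15 then exceeds the maximal order
        5.\<close>
      have "z \<in> generate G {x}" if "z \<in> carrier G" "ord z = 5" for z
        using ok[of z] that k3 by (auto simp: outside_def)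
      then have "ord (x \<otimes> y) = 15" using ord_15_if_unique_subgroup[OF fin x 3] y ok k3 outsideD by blast
      then show ?thesis using max[of "x \<otimes> y"] y x 3 outsideD by simp
    next
      case k5: 3
      then show ?thesis using iso_elementary_abelian[of 5] ok 3 by simp
    qed
  qed
qed

lemma prime_power_outsideE:
  assumes "prime p" "ord x = p ^ Suc a" "g \<in> outside"
  obtains j d where "2 \<le> j" "j \<le> k" "d dvd p ^ a" "ord g = j * d" "j * d \<le> p ^ Suc a"
    "j * d dvd k * p ^ Suc a"
proof -
  obtain j d where jd: "2 \<le> j" "j \<le> k" "d dvd ord x" "ord g = j * d" "d > 0" "j * d \<le> ord x"
    "j * d dvd k * ord x" by (rule outsideE[OF assms(3)])
  have "2 * d \<le> ord x" using mult_le_mono1[OF jd(1), of d] jd(6) by (rule le_trans)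
  then have "d dvd p ^ a" using proper_divisor_prime_power[of p d a] jd(3) assms by simp
  then show ?thesis using that jd assms(2) by metis
qed

lemma prime_le_card_outer:
  assumes p: "prime p" and "ord x = p ^ Suc a"
  shows "p \<le> card outer"
proof -
  have pos: "p ^ a > 0" using p by (simp add: prime_gt_0_nat)
  have "ord x \<le> card outer * p ^ a"
    using proper_divisor_prime_power[OF p, of _ a] assms(2) pos
    by (intro m_le) (simp add: dvd_imp_le)
  then have "p * p ^ a \<le> card outer * p ^ a" using assms(2) by simp
  then show ?thesis using pos by (simp only: mult_le_cancel2)
qed

text \<open>Four outer subgroups leave \<open>p \<le> 3\<close> and \<open>k \<le> 3\<close>, hence
  the group orders 8, 12, 18 and 27, of which only 8 survives.\<close>

lemma case_prime_square:
  assumes p: "prime p" and m: "ord x = p ^ 2" and \<tau>: "card {d. d dvd ord x} = 3"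
  shows "G \<cong> dihedral_group 4"
proof -
  have m': "ord x = p ^ Suc 1" using m by (simp add: power2_eq_square)
  have c: "card outer = 4" using card_outer \<tau> by simp
  have k4: "k \<le> 4" using k_minus_1_less c by simp
  consider "p = 2" | "p = 3" using prime_le_4_cases[OF p] prime_le_card_outer[OF p m'] c by auto
  then show ?thesis
  proof cases
    case 1
    then have m4: "ord x = 4" using m by simp
    have e: "ord g = 2 \<or> ord g = 3 \<or> ord g = 4" if g: "g \<in> outside" for g
    proof -
      obtain j d where jd: "2 \<le> j" "j \<le> k" "d dvd ord x" "ord g = j * d" "d > 0" "j * d \<le> ord x"
        "j * d dvd k * ord x" by (rule outsideE[OF g])
      have "2 * 1 \<le> j * d" using jd by (intro mult_le_mono) auto
      then show ?thesis using jd(4,6) m4 by linarith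
    qed
    have le: "totient (ord g) \<le> 2" and ge: "1 \<le> totient (ord g)" if "g \<in> outside" for g
      using e[OF that] by auto
    have "(k - 1) * 4 \<le> 4 * 2" using sum_outer_le[OF le] c m4 by simp
    then consider "k = 2" | "k = 3" using k by linarith
    then show ?thesis
    proof cases
      case 1
      then have "totient (ord g) = 1" if "g \<in> outside" for g
        using sum_outer_eqD'[OF ge _ that] c m4 by simp
      then have "ord g = 2" if "g \<in> outside" for g using e[OF that] that by fastforce
      then show ?thesis using iso_dihedral_group 1 m4 by simp
    next
      case 2
      \<comment> \<open>The sum 8 is the largest possible for four summands at most 2. So no
        involution lies outside, and \<open>x^2\<close> is the only one.\<close>
      then have "totient (ord g) = 2" if "g \<in> outside" for g
        using sum_outer_eqD[OF le _ that] c m4 by simp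
      then have no2: "ord g \<noteq> 2" if "g \<in> outside" for g using that by fastforce
      have z: "x [^] (2::nat) \<in> carrier G" "ord (x [^] (2::nat)) = 2"
        using ord_pow[OF x, of 2] x m4 by simp_all
      then have "y = x [^] (2::nat)" if "y \<in> carrier G" "ord y = 2" for y
        using involution_unique[OF no2 that z] by simp
      then show ?thesis using no_order_12[OF _ _ z] order 2 m4 by simp
    qed
  next
    case 2
    then have m9: "ord x = 9" using m by simp
    have e: "ord g \<ge> 2 \<and> ord g \<le> 9" if g: "g \<in> outside" for g
    proof -
      obtain j d where jd: "2 \<le> j" "j \<le> k" "d dvd ord x" "ord g = j * d" "d > 0" "j * d \<le> ord x"
        "j * d dvd k * ord x" by (rule outsideE[OF g])
      have "2 * 1 \<le> j * d" using jd by (intro mult_le_mono) auto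
      then show ?thesis using jd(4,6) m9 by simp
    qed
    have le: "totient (ord g) \<le> 6" if "g \<in> outside" for g
    proof -
      have "ord g = 2 \<or> ord g = 3 \<or> ord g = 4 \<or> ord g = 5 \<or> ord g = 6 \<or> ord g = 7 \<or> ord g = 8 \<or> ord g = 9"
        using e[OF that] by linarith
      then show ?thesis by (elim disjE) simp_all
    qed
    have "(k - 1) * 9 \<le> 4 * 6" using sum_outer_le[OF le] c m9 by simp
    then consider "k = 2" | "k = 3" using k by linarith
    then show ?thesis
    proof cases
      case k2: 1
      \<comment> \<open>Outside orders are \<open>2 * 1\<close> or \<open>2 * 3\<close>, so the four
        summands give at most 8, less than 9.\<close>
      have "totient (ord g) \<le> 2" if g: "g \<in> outside" for g
      proof -
        obtain j d where jd: "2 \<le> j" "j \<le> k" "d dvd p ^ 1" "ord g = j * d" "j * d \<le> p ^ Suc 1"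
          "j * d dvd k * p ^ Suc 1" by (rule prime_power_outsideE[OF p m' g])
        have "d = 1 \<or> d = 3" using jd(3) 2 p by (auto simp: prime_nat_iff)
        moreover have "j = 2" using jd k2 by simp
        ultimately show ?thesis using jd(4) by auto
      qed
      then show ?thesis using sum_outer_le[of 2] c m9 k2 by simp
    next
      case k3: 2
      \<comment> \<open>Each summand is 2 or 6, so four of them sum to a multiple of 4, but the
        required sum is 18. With 2 added to each, the sum is \<open>18 + 4 * 2 = 26\<close>.\<close>
      have "4 dvd totient (ord g) + 2" if g: "g \<in> outside" for g
      proof -
        have "ord g dvd 3 ^ 3" using ord_dvd_group_order[of g] outsideD[OF g] order k3 m9 by simp
        then obtain i where i: "i \<le> 3" "ord g = 3 ^ i" using divides_primepow_nat[of 3 "ord g" 3] by auto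
        then have "i = 0 \<or> i = 1 \<or> i = 2 \<or> i = 3" by linarith
        then have "ord g = 3 \<or> ord g = 9" using e[OF g] i(2) by (elim disjE) simp_all
        then show ?thesis by auto
      qed
      then have "4 dvd (\<Sum>H\<in>outer. totient (card H) + 2)"
        by (intro dvd_sum) (metis outerE)
      moreover have "(\<Sum>H\<in>outer. totient (card H) + 2) = 26"
        unfolding sum.distrib using sum_outer c k3 m9 by simp
      ultimately show ?thesis by simp
    qed
  qed
qed

text \<open>With three outer subgroups only the values 8, 2 and 27, 3 of \<open>ord x\<close>,
  \<open>k\<close> pass the count. There the count fixes the outside orders, and an outside element
  of prime order contradicts them.\<close>

lemma not_prime_cube:
  assumes p: "prime p" and m: "ord x = p ^ 3" and \<tau>: "card {d. d dvd ord x} = 4"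
  shows False
proof -
  have m': "ord x = p ^ Suc 2" using m by (simp add: numeral_eq_Suc)
  have c: "card outer = 3" using card_outer \<tau> by simp
  have "k \<le> 3" using k_minus_1_less c by simp
  then have k23: "k = 2 \<or> k = 3" using k by linarith
  consider "p = 2" | "p = 3" using prime_le_4_cases[OF p] prime_le_card_outer[OF p m'] c by auto
  then show ?thesis
  proof cases
    case p2: 1
    then have m8: "ord x = 8" using m by simp
    have e: "\<exists>j d. 2 \<le> j \<and> j \<le> k \<and> (d = 1 \<or> d = 2 \<or> d = 4) \<and> ord g = j * d \<and> j * d \<le> 8"
      if g: "g \<in> outside" for g
    proof -
      obtain j d where jd: "2 \<le> j" "j \<le> k" "d dvd p ^ 2" "ord g = j * d" "j * d \<le> p ^ Suc 2"
        "j * d dvd k * p ^ Suc 2" by (rule prime_power_outsideE[OF p m' g])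
      obtain i where i: "i \<le> 2" "d = 2 ^ i" using jd(3) p2 divides_primepow_nat[of 2 d 2] by auto
      then have "i = 0 \<or> i = 1 \<or> i = 2" by linarith
      then have "d = 1 \<or> d = 2 \<or> d = 4" using i(2) by (elim disjE) simp_all
      moreover have "j * d \<le> 8" using jd(5) p2 by simp
      ultimately show ?thesis using jd by blast
    qed
    have "k \<noteq> 3"
    proof
      assume k3: "k = 3"
      have "totient (ord g) \<le> 4" if g: "g \<in> outside" for g
      proof -
        obtain j d where jd: "2 \<le> j" "j \<le> k" "d = 1 \<or> d = 2 \<or> d = 4" "ord g = j * d" "j * d \<le> 8"
          using e[OF g] by blast
        then have "j = 2 \<or> j = 3" using k3 by linarith
        then have "ord g = 2 \<or> ord g = 3 \<or> ord g = 4 \<or> ord g = 6 \<or> ord g = 8"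
          using jd(3-5) by (elim disjE) simp_all
        then show ?thesis by (elim disjE) simp_all
      qed
      then show False using sum_outer_le[of 4] c m8 k3 by simp
    qed
    then have k2: "k = 2" using k23 by simp
    have e2: "ord g = 2 \<or> ord g = 4 \<or> ord g = 8" if g: "g \<in> outside" for g
      using e[OF g] k2 by (auto dest: antisym)
    obtain A B C where ABC: "outer = {A, B, C}" "A \<noteq> B" "A \<noteq> C" "B \<noteq> C"
      using c unfolding card_3_iff by metis
    have "totient (card A) + (totient (card B) + totient (card C)) = 8"
      using sum_outer k2 m8 ABC by simp
    moreover have "card H = 2 \<or> card H = 4 \<or> card H = 8" if "H \<in> outer" for H
      using that e2 by (metis outerE)
    then have vals: "card A = 2 \<or> card A = 4 \<or> card A = 8" "card B = 2 \<or> card B = 4 \<or> card B = 8"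
      "card C = 2 \<or> card C = 4 \<or> card C = 8" using ABC(1) by blast+
    \<comment> \<open>Three numbers from \<open>{1, 2, 4}\<close> with sum 8 are 2, 2, 4 in some
      order, so the outer subgroups have orders 4, 4 and 8.\<close>
    ultimately have no2: "card A \<noteq> 2 \<and> card B \<noteq> 2 \<and> card C \<noteq> 2"
      and ex8: "card A = 8 \<or> card B = 8 \<or> card C = 8" by (elim disjE; simp)+
    have "\<exists>H\<in>outer. card H = 8" using ex8 ABC(1) by blast
    then obtain y where y: "y \<in> outside" "ord y = 8" by (metis outerE)
    have "ord g \<noteq> 2" if "g \<in> outside" for g
      using generate_in_outer[OF that] no2 ABC(1) by auto
    moreover obtain g where "g \<in> carrier G" "g \<notin> generate G {x}" "ord g = 2"
      using ex_ord_2_outside[OF fin _ x, of 3 y] y outsideD[OF y(1)] m8 order k2 by auto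
    ultimately show False by (auto simp: outside_def)
  next
    case p3: 2
    then have m27: "ord x = 27" using m by simp
    have t18: "totient 18 = 6" using totient_double[of 9] by simp
    have t27: "totient 27 = 18" using totient_prime_power[of 3 3] by simp
    have "k \<noteq> 2"
    proof
      assume k2: "k = 2"
      have "totient (ord g) \<le> 6" if g: "g \<in> outside" for g
      proof -
        obtain j d where jd: "2 \<le> j" "j \<le> k" "d dvd p ^ 2" "ord g = j * d" "j * d \<le> p ^ Suc 2"
          "j * d dvd k * p ^ Suc 2" by (rule prime_power_outsideE[OF p m' g])
        obtain i where i: "i \<le> 2" "d = 3 ^ i" using jd(3) p3 divides_primepow_nat[of 3 d 2] by auto
        then have "i = 0 \<or> i = 1 \<or> i = 2" by linarith
        then have "d = 1 \<or> d = 3 \<or> d = 9" using i(2) by (elim disjE) simp_all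
        moreover have "j = 2" using jd k2 by simp
        ultimately have "ord g = 2 \<or> ord g = 6 \<or> ord g = 18" using jd(4) by auto
        then show ?thesis using t18 by (elim disjE) simp_all
      qed
      then show False using sum_outer_le[of 6] c m27 k2 by simp
    qed
    then have k3: "k = 3" using k23 by simp
    have e: "ord g = 1 \<or> ord g = 3 \<or> ord g = 9 \<or> ord g = 27" if g: "g \<in> outside" for g
    proof -
      have "ord g dvd 3 ^ 4" using ord_dvd_group_order[of g] outsideD[OF g] order k3 m27 by simp
      then obtain i where i: "i \<le> 4" "ord g = 3 ^ i" using divides_primepow_nat[of 3 "ord g" 4] by auto
      then have "i = 0 \<or> i = 1 \<or> i = 2 \<or> i = 3 \<or> i = 4" by linarith
      then show ?thesis using max[of g] outsideD[OF g] m27 i(2) by (elim disjE) simp_all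
    qed
    have le: "totient (ord g) \<le> 18" if g: "g \<in> outside" for g
      using e[OF g] t27 by auto
    \<comment> \<open>The required sum \<open>54 = 3 * 18\<close> is the maximum, so the count is
      tight.\<close>
    have tot: "totient (ord g) = 18" if "g \<in> outside" for g
      using sum_outer_eqD[OF le _ that] c m27 k3 by simp
    have e27: "ord g = 27" if "g \<in> outside" for g
      using e[OF that] tot[OF that] by auto
    obtain y where y: "y \<in> outside" using ex_outside by blast
    obtain g where "g \<in> carrier G" "g \<notin> generate G {x}" "ord g = 3"
      using ex_ord_3_outside[OF fin _ x, of 3 y] outsideD[OF y] e27[OF y] m27 order k3 by auto
    then show False using e27[of g] by (simp add: outside_def)
  qed
qed

text \<open>Two outer subgroups force \<open>k = 2\<close> and \<open>p = 2\<close>. The required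
  sum \<open>16 = 2 * 8\<close> is the maximum, so all outside orders are 16, against the existence
  of an involution outside.\<close>

lemma not_prime_fourth:
  assumes p: "prime p" and m: "ord x = p ^ 4" and \<tau>: "card {d. d dvd ord x} = 5"
  shows False
proof -
  have m': "ord x = p ^ Suc 3" using m by (simp add: numeral_eq_Suc)
  have c: "card outer = 2" using card_outer \<tau> by simp
  have k2: "k = 2" using k_minus_1_less c k by simp
  have p2: "p = 2" using prime_le_card_outer[OF p m'] c prime_ge_2_nat[OF p] by simp
  have m16: "ord x = 16" using m p2 by simp
  have t16: "totient 16 = 8" using totient_prime_power[of 2 4] by simp
  have e: "ord g = 2 \<or> ord g = 4 \<or> ord g = 8 \<or> ord g = 16" if g: "g \<in> outside" for g
  proof -
    obtain j d where jd: "2 \<le> j" "j \<le> k" "d dvd p ^ 3" "ord g = j * d" "j * d \<le> p ^ Suc 3"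
      "j * d dvd k * p ^ Suc 3" by (rule prime_power_outsideE[OF p m' g])
    obtain i where i: "i \<le> 3" "d = 2 ^ i" using jd(3) p2 divides_primepow_nat[of 2 d 3] by auto
    then have "i = 0 \<or> i = 1 \<or> i = 2 \<or> i = 3" by linarith
    moreover have "j = 2" using jd k2 by simp
    ultimately show ?thesis using jd(4) i(2) by (elim disjE) simp_all
  qed
  have le: "totient (ord g) \<le> 8" if g: "g \<in> outside" for g
    using e[OF g] t16 by auto
  have tot: "totient (ord g) = 8" if "g \<in> outside" for g
    using sum_outer_eqD[OF le _ that] c m16 k2 by simp
  have e16: "ord g = 16" if "g \<in> outside" for g
    using e[OF that] tot[OF that] by auto
  obtain y where y: "y \<in> outside" using ex_outside by blast
  obtain g where "g \<in> carrier G" "g \<notin> generate G {x}" "ord g = 2"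
    using ex_ord_2_outside[OF fin _ x, of 4 y] outsideD[OF y] e16[OF y] m16 order k2 by auto
  then show False using e16[of g] by (simp add: outside_def)
qed

text \<open>Proper divisors are at most \<open>q\<close>, so \<open>p * q \<le> 3 * q\<close> and
  \<open>p \<le> 3\<close>. For \<open>p = 3\<close> each summand would have to equal
  \<open>(k - 1) * q\<close>, which is too large for a totient here; for \<open>p = 2\<close> all
  outside orders turn out to be 4, and the sum gives \<open>q = 3\<close>.\<close>

lemma case_semiprime:
  assumes p: "prime p" and q: "prime q" and pq: "p < q"
    and m: "ord x = p * q" and \<tau>: "card {d. d dvd ord x} = 4"
  shows "G \<cong> Z3_semidirect_Z4"
proof -
  have c: "card outer = 3" using card_outer \<tau> by simp
  have q0: "q > 0" using q by (rule prime_gt_0_nat)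
  have div: "d = 1 \<or> d = p \<or> d = q" if d: "d dvd ord x" "2 * d \<le> ord x" for d
  proof -
    obtain a b where ab: "d = a * b" "a dvd p" "b dvd q" using d(1) m division_decomp by metis
    then have "a = 1 \<or> a = p" "b = 1 \<or> b = q" using p q by (auto simp: prime_nat_iff)
    moreover have "d \<noteq> p * q" using d(2) m m_pos by (intro notI) simp
    ultimately show ?thesis using ab(1) by auto
  qed
  have dq: "d \<le> q" if "d dvd ord x" "2 * d \<le> ord x" for d
    using div[OF that] pq q0 by auto
  have "p * q \<le> 3 * q" using m_le[of q] dq m c by simp
  then have "p \<le> 3" using q0 by simp
  then consider "p = 3" | "p = 2" using prime_le_4_cases[OF p] by auto
  then show ?thesis
  proof cases
    case p3: 1
    obtain y where y: "y \<in> outside" using ex_outside by blast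
    obtain j d where jd: "2 \<le> j" "j \<le> k" "d dvd ord x" "ord y = j * d" "d > 0" "j * d \<le> ord x"
      "j * d dvd k * ord x" by (rule outsideE[OF y])
    have "2 * d \<le> ord x" using mult_le_mono1[OF jd(1), of d] jd(6) by (rule le_trans)
    then have "d \<le> q" using dq jd(3) by blast
    have le: "totient (ord g) \<le> (k - 1) * q" if "g \<in> outside" for g
      by (rule totient_outside_le[OF that dq])
    have "totient (ord y) = (k - 1) * q"
      using sum_outer_eqD[OF le _ y] c m p3 by simp
    \<comment> \<open>Tightness forces \<open>d = q\<close> and \<open>j = k\<close> in
      \<open>ord y = j * d\<close>.\<close>
    then have kq: "(k - 1) * q \<le> (j - 1) * d" using totient_mult_le[OF jd(1)] jd(4) by metis
    also have "\<dots> \<le> (k - 1) * d" using jd(2) by (intro mult_le_mono1) simp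
    finally have "q \<le> d" using k by simp
    then have "d = q" using \<open>d \<le> q\<close> by simp
    then have "k - 1 \<le> j - 1" using kq q0 by simp
    then have "j = k" using jd(1,2) by simp
    have "k \<le> 3" using jd(6) m p3 q0 \<open>d = q\<close> \<open>j = k\<close> by simp
    then have "\<not> q dvd k" using pq p3 k by (intro nat_dvd_not_less) auto
    then have "coprime k q" using q prime_imp_coprime[of q k] by (simp add: coprime_commute)
    \<comment> \<open>As \<open>k \<le> 3 < q\<close>, the totient of \<open>k * q\<close> factors,
      and \<open>totient q = q - 1\<close> makes it smaller than \<open>(k - 1) * q\<close>.\<close>
    then have "totient (ord y) = totient k * totient q"
      using jd(4) \<open>d = q\<close> \<open>j = k\<close> totient_mult_coprime by simp
    also have "\<dots> \<le> (k - 1) * (q - 1)"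
      using totient_less[of k] totient_prime[OF q] k by (intro mult_le_mono) auto
    also have "\<dots> < (k - 1) * q" using k q0 by simp
    finally show ?thesis using \<open>totient (ord y) = (k - 1) * q\<close> by simp
  next
    case p2: 2
    then have q3: "q \<ge> 3" using pq by simp
    have "odd q" using q pq p2 prime_odd_nat by blast
    have t2q: "totient (2 * q) = q - 1" using totient_double[of q] \<open>odd q\<close> totient_prime[OF q] by simp
    \<comment> \<open>The outside orders are \<open>j\<close>, \<open>2 * j\<close> or
      \<open>2 * q\<close>. The first two have totient at most \<open>j \<le> k\<close>, the last
      one has totient \<open>q - 1\<close>.\<close>
    have le: "totient (ord g) \<le> Max {q - 1, k}" if g: "g \<in> outside" for g
    proof -
      obtain j d where jd: "2 \<le> j" "j \<le> k" "d dvd ord x" "ord g = j * d" "d > 0" "j * d \<le> ord x"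
        "j * d dvd k * ord x" by (rule outsideE[OF g])
      have "2 * d \<le> ord x" using mult_le_mono1[OF jd(1), of d] jd(6) by (rule le_trans)
      then consider "d = 1" | "d = 2" | "d = q" using div jd(3) p2 by blast
      then have "totient (ord g) \<le> k \<or> totient (ord g) \<le> q - 1"
      proof cases
        case 1
        then show ?thesis using jd totient_le[of j] by simp
      next
        case 2
        then show ?thesis using jd totient_mult_le[of 2 j] by (simp add: mult.commute)
      next
        case 3
        then have "j = 2" using jd(1,6) m p2 q0 by simp
        then show ?thesis using jd(4) 3 t2q by simp
      qed
      then show ?thesis by auto
    qed
    have bound: "(k - 1) * (2 * q) \<le> 3 * Max {q - 1, k}" using sum_outer_le[OF le] c m p2 by simp
    \<comment> \<open>For \<open>k \<ge> 3\<close> the bound would give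
      \<open>4 * q \<le> 3 * (q - 1)\<close> or \<open>6 * (k - 1) \<le> 3 * k\<close>; both
      fail.\<close>
    have k2: "k = 2"
    proof (rule ccontr)
      assume "k \<noteq> 2"
      then have k3: "k \<ge> 3" using k by simp
      show False
      proof (cases "k \<le> q - 1")
        case True
        have "2 * (2 * q) \<le> (k - 1) * (2 * q)" using k3 by (intro mult_le_mono1) simp
        also have "\<dots> \<le> 3 * (q - 1)" using bound True by simp
        finally show False using q0 by simp
      next
        case False
        have "(k - 1) * 6 \<le> (k - 1) * (2 * q)" using q3 by (intro mult_le_mono2) simp
        also have "\<dots> \<le> 3 * k" using bound False by simp
        finally show False using k3 by simp
      qed
    qed
    have e: "ord g = 2 \<or> ord g = 4 \<or> ord g = 2 * q" if g: "g \<in> outside" for g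
    proof -
      obtain j d where jd: "2 \<le> j" "j \<le> k" "d dvd ord x" "ord g = j * d" "d > 0" "j * d \<le> ord x"
        "j * d dvd k * ord x" by (rule outsideE[OF g])
      have "j = 2" using jd(1,2) k2 by simp
      then have "d = 1 \<or> d = 2 \<or> d = q" using div[of d] jd(3,6) p2 by simp
      then show ?thesis using jd(4) \<open>j = 2\<close> by auto
    qed
    have leq: "totient (ord g) \<le> q - 1" if "g \<in> outside" for g
      using e[OF that] t2q q3 by auto
    have no2: "ord g \<noteq> 2" if g: "g \<in> outside" for g
    proof
      assume "ord g = 2"
      \<comment> \<open>One summand 1 and two summands at most \<open>q - 1\<close> stay below the
        required sum \<open>2 * q\<close>.\<close>
      then have "(k - 1) * ord x \<le> 1 + (card outer - 1) * (q - 1)"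
        using g leq by (intro sum_outer_le_one[of _ g]) simp_all
      then have "2 * q \<le> 1 + 2 * (q - 1)" using k2 m p2 c by simp
      then show False using q3 by linarith
    qed
    have no2q: "ord g \<noteq> 2 * q" if g: "g \<in> outside" for g
    proof
      assume og: "ord g = 2 * q"
      have gG: "g \<in> carrier G" and gM: "g \<notin> generate G {x}" using outsideD[OF g] by auto
      obtain t where t: "0 < t" "t \<le> 2" "g [^] (t::nat) \<in> generate G {x}"
        using ex_pow_mem_subgroup[OF fin M, of 2 g] order k2 gG generate_pow_card[OF x] by auto
      have "t \<noteq> 1" using t(3) gM gG by auto
      then have "t = 2" using t(1,2) by linarith
      then have g2: "g [^] (2::nat) \<in> generate G {x}" using t(3) by simp
      have "ord (g [^] q) = 2" using ord_pow[OF gG, of q] og q0 by simp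
      then have gq: "g [^] q \<in> generate G {x}" using no2[of "g [^] q"] gG by (auto simp: outside_def)
      \<comment> \<open>Both \<open>g^2\<close> and \<open>g^q\<close> lie in
        \<open>\<langle>x\<rangle>\<close>; as \<open>q\<close> is odd, so does
        \<open>g\<close>.\<close>
      obtain r where r: "q = 2 * r + 1" using \<open>odd q\<close> by (auto elim: oddE)
      have "(g [^] (2::nat)) [^] r \<in> generate G {x}"
        using g2 M by (induction r) (auto simp: subgroup.m_closed subgroup.one_closed)
      moreover have "(g [^] (2::nat)) [^] r \<otimes> g \<in> generate G {x}"
        using gq r gG by (simp add: nat_pow_pow)
      ultimately show False using mult_mem_subgroup_iff(1)[OF M _ gG] gM by blast
    qed
    have e4: "ord g = 4" if "g \<in> outside" for g
      using e[OF that] no2[OF that] no2q[OF that] by blast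
    then have "totient (ord g) \<le> 2" if "g \<in> outside" for g using that by simp
    then have "2 * q \<le> 3 * 2" using sum_outer_le[of 2] c m p2 k2 by simp
    then have "q = 3" using q3 by simp
    then show ?thesis using iso_Z3_semidirect_Z4[OF k2 _ e4] m p2 by simp
  qed
qed

lemma classification:
  "G \<cong> dihedral_group 4 \<or> G \<cong> dihedral_group 5 \<or> G \<cong> Z3_semidirect_Z4 \<or>
    G \<cong> integer_mod_group 5 \<times>\<times> integer_mod_group 5"
proof -
  have "ord x > 1" using m_ge_2 by simp
  from card_divisors_m this show ?thesis
  proof (rule card_divisors_le_5, goal_cases)
    case 1
    then show ?thesis using case_prime by blast
  next
    case (2 p)
    then show ?thesis using case_prime_square by blast
  next
    case (3 p)
    then show ?thesis using not_prime_cube by blast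
  next
    case (4 p)
    then show ?thesis using not_prime_fourth by blast
  next
    case (5 p q)
    then show ?thesis using case_semiprime by blast
  qed
qed

end

theorem theorem4p2:
  fixes G :: "('a, 'b) monoid_scheme"
  assumes "group G" and "finite (carrier G)"
  shows "card (cyclic_subgroups G) = 7 \<longleftrightarrow>
    G \<cong> dihedral_group 4 \<or>
    G \<cong> dihedral_group 5 \<or>
    G \<cong> Z3_semidirect_Z4 \<or>
    G \<cong> integer_mod_group 5 \<times>\<times> integer_mod_group 5 \<or>
    (\<exists>p::nat. Factorial_Ring.prime p \<and> G \<cong> integer_mod_group (p ^ 6))"
    (is "?L \<longleftrightarrow> ?R")
proof
  interpret group G by fact
  note fin = assms(2)
  assume L: ?L
  obtain x where x: "x \<in> carrier G" and max: "\<And>g. g \<in> carrier G \<Longrightarrow> ord g \<le> ord x"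
  proof -
    have "Max (ord ` carrier G) \<in> ord ` carrier G" using fin by (intro Max_in) auto
    then obtain x where "x \<in> carrier G" "ord x = Max (ord ` carrier G)" by auto
    then show ?thesis using that fin by simp
  qed
  obtain k where k: "order G = k * ord x" using ord_dvd_group_order[OF x] by (metis dvdE mult.commute)
  have n0: "order G > 0" using fin order_gt_0_iff_finite by blast
  show ?R
  \<comment> \<open>The case \<open>k = 1\<close> is the cyclic one, where the order has seven
    divisors. Otherwise \<open>k \<ge> 2\<close>, because \<open>k = 0\<close> would make the order
    \<open>0\<close>.\<close>
  proof (cases "k = 1")
    case True
    then have ox: "ord x = order G" using k by simp
    then have "card {d. d dvd order G} = 7" using card_cyclic_subgroups_cyclic[OF fin x] L by simp
    then obtain p where "prime p" "order G = p ^ 6" using card_divisors_eq_7 n0 by blast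
    then show ?thesis using iso_integer_mod_group[OF fin x ox] by auto
  next
    case False
    then have "k \<ge> 2" using k n0 by (cases k) auto
    then interpret noncyclic_with_7_cyclic_subgroups G x k
      using fin x max k L by unfold_locales auto
    show ?thesis using classification by blast
  qed
next
  assume ?R
  moreover have "card {d::nat. d dvd 4} = 3" "card {d::nat. d dvd 5} = 2"
    using card_divisors_prime_power[of 2 2] card_divisors_prime_power[of 5 1] by simp_all
  then have "card (cyclic_subgroups (dihedral_group 4)) = 7"
    "card (cyclic_subgroups (dihedral_group 5)) = 7"
    using card_cyclic_subgroups_dihedral_group[of 4] card_cyclic_subgroups_dihedral_group[of 5] by simp_all
  moreover have "card (cyclic_subgroups (integer_mod_group 5 \<times>\<times> integer_mod_group 5)) = 7"
    using card_cyclic_subgroups_elementary_abelian[of 5] by simp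
  moreover have "card (cyclic_subgroups (integer_mod_group (p ^ 6))) = 7"
    if "prime p" for p
    using card_cyclic_subgroups_integer_mod_group_prime_power[OF that, of 6] by simp
  ultimately show ?L
    using card_cyclic_subgroups_iso[OF assms(1)] group_dihedral_group group_Z3_semidirect_Z4
      group_integer_mod_group_DirProd group_integer_mod_group card_cyclic_subgroups_Z3_semidirect_Z4
    by metis
qed

end
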